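(* Let $X$ be a random variable with $\mathbf{E}X=0$ and $\mathbf{E}X^2=1$, let $m\in\{0,1,2,\dots\}\cup\{\infty\}$ be such that $\lambda_m$ is defined, and let $n=n(a)$ be a positive-integer-valued function with $na^2\to\infty$ as $a\to0$. Assume that, as $a\to0$, $$\mathbf{P}(S_j^{(0)}\ge ja)\sim \overline{\Phi}(\sqrt{j}\,a)\exp\{ja^3\lambda_m(a)\}\quad\text{uniformly in integers } j\in[a^{-2},n].$$ Then, as $a\to0$, $$\mathbf{P}(\tau^{(a)}>n)\sim 2\,\mathbf{E}\tau^{(a)}\,\frac1n\,\overline{\Phi}(\sqrt{n}\,a)\exp\{na^3\lambda_m(a)\}.$$
   Context: Let $X,X_1,X_2,\dots$ be i.i.d. with $\mathbf{E}X=0$, and fix $a_0>0$. For $a\in[0,a_0]$ let $S^{(a)}$ be the random walk $S^{(a)}_0=0$, $S^{(a)}_n=\sum_{i=1}^n (X_i-a)$, and let $\tau^{(a)}:=\min\{k\ge1: S^{(a)}_k<0\}$. Limits $a\to0$ are taken along $a>0$; $\sim$ means the ratio tends to $1$, and uniformity in $j$ means that the supremum over $j$ of $|\text{ratio}-1|$ tends to $0$. $\overline{\Phi}(x):=\int_x^\infty\frac{1}{\sqrt{2\pi}}e^{-u^2/2}\,du$. Cram\'er series: let $\gamma_k$ be the $k$-th cumulant of $X$ (so $\gamma_1=0$, $\gamma_2=1$) and let $\Lambda(h)=\sum_{k\ge2}\gamma_kh^k/k!$ as a formal power series. Solve $t=\Lambda'(h)$ formally for $h=h(t)$. The Cram\'er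 series $\lambda(t)=\sum_{k\ge0}\ell_kt^k$ is defined by $t\,h(t)-\Lambda(h(t))=\frac{t^2}{2}-t^3\lambda(t)$; thus $\ell_0=\gamma_3/6$, $\ell_1=(\gamma_4-3\gamma_3^2)/24$, and $\ell_k$ involves only $\gamma_3,\dots,\gamma_{k+3}$. For finite $m$, $\lambda_m(t)=\sum_{k=0}^{m-1}\ell_kt^k$ is the partial sum containing the first $m$ terms ($\lambda_0=0$); for it to be defined it is understood that the moments of $X$ entering it are finite ($\mathbf{E}|X|^{m+2}<\infty$). For $m=\infty$, $\lambda_\infty=\lambda$ and it is understood that $\mathbf{E}e^{h|X|}<\infty$ for some $h>0$, so that the series converges near $0$. *)

theory Defs
  imports
    "HOL-Probability.Probability"
    "HOL-Library.Landau_Symbols"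
    "HOL-Computational_Algebra.Computational_Algebra"
begin

definition std_normal_tail :: "real \<Rightarrow> real" where
  "std_normal_tail x = (LINT u:{x..}|lborel. std_normal_density u)"

definition walk :: "(nat \<Rightarrow> 'a \<Rightarrow> real) \<Rightarrow> real \<Rightarrow> nat \<Rightarrow> 'a \<Rightarrow> real" where
  "walk X a k \<omega> = (\<Sum>i=1..k. (X i \<omega> - a))"

text \<open>The infimum of the empty set in \<^typ>\<open>enat\<close> is \<open>\<infinity>\<close>, the value for paths that never become
  negative.\<close>

definition exit_time :: "(nat \<Rightarrow> 'a \<Rightarrow> real) \<Rightarrow> real \<Rightarrow> 'a \<Rightarrow> enat" where
  "exit_time X a \<omega> = (INF k\<in>{k. 1 \<le> k \<and> walk X a k \<omega> < 0}. enat k)"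

text \<open>For drift \<open>a > 0\<close> the expected exit time is finite, so the conversion by \<^const>\<open>enn2real\<close>
  (which sends \<open>\<infinity>\<close> to \<open>0\<close>) is harmless there.\<close>

definition mean_exit_time :: "'a measure \<Rightarrow> (nat \<Rightarrow> 'a \<Rightarrow> real) \<Rightarrow> real \<Rightarrow> real" where
  "mean_exit_time M X a = enn2real (\<integral>\<^sup>+ \<omega>. ennreal_of_enat (exit_time X a \<omega>) \<partial>M)"

text \<open>Cumulants are read off from the formal logarithm of the formal moment series. The \<open>k\<close>-th
  cumulant depends on the moments of order at most \<open>k\<close> only, hence it is the usual one whenever
  these exist; a moment that does not exist enters with the default value \<open>0\<close> and spoils cumulants
  of at least its own order only.\<close>

definition moment_series :: "'a measure \<Rightarrow> ('a \<Rightarrow> real) \<Rightarrow> real fps" where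
  "moment_series M Y = Abs_fps (\<lambda>k. (LINT \<omega>|M. Y \<omega> ^ k) / fact k)"

definition cumulant :: "'a measure \<Rightarrow> ('a \<Rightarrow> real) \<Rightarrow> nat \<Rightarrow> real" where
  "cumulant M Y k = fact k * ((fps_ln 1 oo (moment_series M Y - 1)) $ k)"

text \<open>Formal power series built from a cumulant sequence \<open>\<gamma>\<close> with \<open>\<gamma> 2 = 1\<close>. The
  compositional inverse solves \<open>t = \<Lambda>'(h)\<close>, and the shift divides by \<open>t\<^sup>3\<close>;
  see \<open>cramer_saddle_solves\<close> and \<open>cramer_series_equation\<close> below.\<close>

definition cramer_Lambda :: "(nat \<Rightarrow> real) \<Rightarrow> real fps" where
  "cramer_Lambda \<gamma> = Abs_fps (\<lambda>k. if k \<ge> 2 then \<gamma> k / fact k else 0)"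

definition cramer_saddle :: "(nat \<Rightarrow> real) \<Rightarrow> real fps" where
  "cramer_saddle \<gamma> = fps_inv (fps_deriv (cramer_Lambda \<gamma>))"

definition cramer_series :: "(nat \<Rightarrow> real) \<Rightarrow> real fps" where
  "cramer_series \<gamma> = fps_shift 3
     (fps_const (1/2) * fps_X ^ 2
       - (fps_X * cramer_saddle \<gamma> - (cramer_Lambda \<gamma> oo cramer_saddle \<gamma>)))"

definition cramer_sum :: "'a measure \<Rightarrow> ('a \<Rightarrow> real) \<Rightarrow> enat \<Rightarrow> real \<Rightarrow> real" where
  "cramer_sum M Y m t =
     (case m of
        enat m' \<Rightarrow> (\<Sum>k<m'. cramer_series (cumulant M Y) $ k * t ^ k)
      | \<infinity> \<Rightarrow> eval_fps (cramer_series (cumulant M Y)) t)"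

definition cramer_sum_defined :: "'a measure \<Rightarrow> ('a \<Rightarrow> real) \<Rightarrow> enat \<Rightarrow> bool" where
  "cramer_sum_defined M Y m =
     (case m of
        enat m' \<Rightarrow> integrable M (\<lambda>\<omega>. \<bar>Y \<omega>\<bar> ^ (m' + 2))
      | \<infinity> \<Rightarrow> (\<exists>h>0. integrable M (\<lambda>\<omega>. exp (h * \<bar>Y \<omega>\<bar>))))"

lemma cramer_saddle_0 [simp]: "cramer_saddle \<gamma> $ 0 = 0"
  by (simp add: cramer_saddle_def fps_inv_def)

lemma cramer_saddle_solves:
  assumes "\<gamma> 2 = 1"
  shows "fps_deriv (cramer_Lambda \<gamma>) oo cramer_saddle \<gamma> = fps_X"
  unfolding cramer_saddle_def
  by (rule fps_inv_right) (use assms in \<open>simp_all add: cramer_Lambda_def numeral_2_eq_2\<close>)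

lemma cramer_saddle_coeffs:
  assumes "\<gamma> 2 = 1"
  shows "cramer_saddle \<gamma> $ Suc 0 = 1"
    and "cramer_saddle \<gamma> $ 2 = - \<gamma> 3 / 2"
    and "cramer_saddle \<gamma> $ 3 = \<gamma> 3 ^ 2 / 2 - \<gamma> 4 / 6"
proof -
  let ?h = "cramer_saddle \<gamma>"
  have e: "(fps_deriv (cramer_Lambda \<gamma>) oo ?h) $ k = (fps_X :: real fps) $ k" for k
    using cramer_saddle_solves[of \<gamma>, OF assms] by simp
  show 1: "?h $ Suc 0 = 1"
    using e[of 1] assms
    by (simp add: fps_compose_nth cramer_Lambda_def numeral_2_eq_2)
  show 2: "?h $ 2 = - \<gamma> 3 / 2"
    using e[of 2] assms 1
    by (simp add: fps_compose_nth cramer_Lambda_def eval_nat_numeral fps_mult_nth)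
  show "?h $ 3 = \<gamma> 3 ^ 2 / 2 - \<gamma> 4 / 6"
    using e[of 3] assms 1 2
    by (simp add: fps_compose_nth cramer_Lambda_def eval_nat_numeral fps_mult_nth)
qed

lemma cramer_series_equation:
  assumes "\<gamma> 2 = 1"
  shows "fps_X * cramer_saddle \<gamma> - (cramer_Lambda \<gamma> oo cramer_saddle \<gamma>)
           = fps_const (1/2) * fps_X ^ 2 - fps_X ^ 3 * cramer_series \<gamma>"
proof -
  let ?D = "fps_const (1/2) * fps_X ^ 2
       - (fps_X * cramer_saddle \<gamma> - (cramer_Lambda \<gamma> oo cramer_saddle \<gamma>))"
  have "?D $ k = 0" if "k < 3" for k
  proof -
    have "k = 0 \<or> k = 1 \<or> k = 2" using that by auto
    then show ?thesis
      using assms cramer_saddle_coeffs[of \<gamma>, OF assms]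
      by (auto simp: fps_compose_nth cramer_Lambda_def eval_nat_numeral fps_mult_nth)
  qed
  then have "fps_X ^ 3 * cramer_series \<gamma> = ?D"
    unfolding cramer_series_def
    by (intro fps_ext) (auto simp: fps_X_power_mult_nth)
  then show ?thesis by (simp add: algebra_simps)
qed

lemma cramer_series_coeffs:
  assumes "\<gamma> 2 = 1"
  shows "cramer_series \<gamma> $ 0 = \<gamma> 3 / 6"
    and "cramer_series \<gamma> $ 1 = (\<gamma> 4 - 3 * \<gamma> 3 ^ 2) / 24"
proof -
  have h: "cramer_saddle \<gamma> $ Suc 0 = 1" "cramer_saddle \<gamma> $ Suc (Suc 0) = - \<gamma> 3 / 2"
    "cramer_saddle \<gamma> $ Suc (Suc (Suc 0)) = \<gamma> 3 ^ 2 / 2 - \<gamma> 4 / 6"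
    using cramer_saddle_coeffs[of \<gamma>, OF assms] by (simp_all add: numeral_2_eq_2 numeral_3_eq_3)
  show "cramer_series \<gamma> $ 0 = \<gamma> 3 / 6"
    and "cramer_series \<gamma> $ 1 = (\<gamma> 4 - 3 * \<gamma> 3 ^ 2) / 24"
    using assms
    by (simp_all add: cramer_series_def fps_compose_nth cramer_Lambda_def eval_nat_numeral
        fps_mult_nth h) (simp_all add: field_simps)
qed

lemma cumulant_1_2:
  assumes "prob_space M"
  shows "cumulant M Y 1 = (LINT \<omega>|M. Y \<omega>)"
    and "cumulant M Y 2 = (LINT \<omega>|M. Y \<omega> ^ 2) - (LINT \<omega>|M. Y \<omega>) ^ 2"
  using prob_space.prob_space[OF assms]
  by (simp_all add: cumulant_def moment_series_def fps_compose_nth fps_ln_nth eval_nat_numeral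
      fps_mult_nth fps_numeral_nth field_simps)

end

theory Submission
  imports Defs "HOL-Real_Asymp.Real_Asymp"
begin

text \<open>Write \<open>p\<^sub>j = P(S\<^sub>j \<ge> 0)\<close> for the walk with drift \<open>- a\<close> and \<open>b\<^sub>k = P(\<tau> > k)\<close>. The
  Sparre Andersen identity says that \<open>\<Sum> b\<^sub>k z\<^sup>k = exp (\<Sum> p\<^sub>j z\<^sup>j / j)\<close>, equivalently
  \<open>n b\<^sub>n = \<Sum>\<^sub>k\<^sub><\<^sub>n b\<^sub>k p\<^sub>n\<^sub>-\<^sub>k\<close>; at \<open>z = 1\<close> it gives \<open>E \<tau>\<close>. The recursion survives the
  exponential tilting \<open>c\<^sub>k = b\<^sub>k e\<^sup>k\<^sup>\<theta>\<close>, \<open>q\<^sub>j = p\<^sub>j e\<^sup>j\<^sup>\<theta>\<close> with \<open>\<theta> = a\<^sup>2 / 2 - a\<^sup>3 \<lambda>(a)\<close>, after which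
  \<open>q\<^sub>j\<close> decays only like \<open>1 / sqrt (2 \<pi> j a\<^sup>2)\<close>. Hence the \<open>c\<^sub>k\<close> are concentrated on \<open>k = O(1 / a\<^sup>2)\<close>, where
  \<open>q\<^sub>n\<^sub>-\<^sub>k \<approx> q\<^sub>n\<close>, and \<open>n c\<^sub>n \<approx> q\<^sub>n C\<close> with \<open>C = exp (\<Sum>\<^sub>j\<^sub>\<le>\<^sub>n q\<^sub>j / j)\<close>. Finally
  \<open>ln (C / E \<tau>) \<approx> \<Sum> p\<^sub>j (e\<^sup>j\<^sup>\<theta> - 1) / j\<close> is a Riemann sum that the central limit theorem
  turns into an integral with value \<open>ln 2\<close>.\<close>

subsection \<open>Coefficients of the exponential of a power series\<close>

text \<open>The weights \<open>q_j\<close> change with \<open>a\<close>, so a limit theorem for one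
  fixed subexponential sequence does not apply. Hence the renewal argument is a finite inequality
  with constants that do not depend on the scale \<open>h = a^2\<close>. A single term
  \<open>q_n C\<close> survives for two reasons: the mass of \<open>c\<close> beyond
  \<open>m\<close> is \<open>O((m h)^(-1/2)) C\<close>, which removes the middle of the recursion;
  and near \<open>k = n\<close>, where \<open>q_(n-k)\<close> is not small, \<open>c_k\<close>
  itself is of order \<open>k^(-3/2)\<close>. The factor \<open>2\<close> comes from
  \<open>j\<close> of order \<open>a^(-2)\<close>, where the central limit theorem is exact to first
  order: for smaller \<open>j\<close> the difference \<open>exp (j \<theta>) - 1\<close> is small,
  and for larger \<open>j\<close> the terms are of size \<open>(j a^2)^(-3/2) a^2\<close>. The
  Sparre Andersen identity is proved combinatorially, by decomposing a nonnegative path at its first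
  future minimum and counting cyclic rotations.\<close>

definition exp_coeff :: "(nat \<Rightarrow> real) \<Rightarrow> nat \<Rightarrow> real" where
  "exp_coeff r k = (fps_exp 1 oo Abs_fps (\<lambda>j. r j / real j)) $ k"

lemma exp_coeff_0 [simp]: "exp_coeff r 0 = 1"
  by (simp add: exp_coeff_def)

text \<open>Differentiating \<open>C = exp L\<close> gives \<open>z C' = C * (z L')\<close>; the
  factors \<open>1 / j\<close> in \<open>L\<close> make \<open>r j\<close> the coefficients of
  \<open>z L'\<close>.\<close>

lemma exp_coeff_rec:
  "real n * exp_coeff r n = (\<Sum>k<n. exp_coeff r k * r (n - k))"
proof (cases n)
  case (Suc m)
  \<comment> \<open>\<open>r 0 / real 0\<close> is \<open>0\<close>, so \<open>L\<close> has no
    constant term, as the chain rule for composition demands.\<close>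
  define L where "L = Abs_fps (\<lambda>j. r j / real j)"
  have "fps_deriv (fps_exp 1 oo L) = (fps_exp 1 oo L) * fps_deriv L"
    by (subst fps_compose_deriv) (simp_all add: L_def)
  then have "fps_deriv (fps_exp 1 oo L) $ m = ((fps_exp 1 oo L) * fps_deriv L) $ m"
    by (rule arg_cong)
  moreover have "fps_deriv (fps_exp 1 oo L) $ m = real (Suc m) * exp_coeff r (Suc m)"
    by (simp add: exp_coeff_def L_def)
  moreover have "((fps_exp 1 oo L) * fps_deriv L) $ m
      = (\<Sum>k=0..m. exp_coeff r k * (real (Suc (m - k)) * L $ (Suc (m - k))))"
    unfolding fps_mult_nth by (simp add: exp_coeff_def L_def)
  ultimately have "real (Suc m) * exp_coeff r (Suc m)
      = (\<Sum>k=0..m. exp_coeff r k * (real (Suc (m - k)) * L $ (Suc (m - k))))"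
    by simp
  also have "\<dots> = (\<Sum>k<Suc m. exp_coeff r k * r (Suc m - k))"
    by (intro sum.cong) (auto simp: L_def Suc_diff_le simp del: of_nat_Suc)
  finally show ?thesis by (simp add: Suc)
qed simp

text \<open>Each coefficient is determined by the earlier ones. The bound \<open>N\<close> is there
  for weights that are cut off at some index.\<close>

lemma exp_coeff_unique:
  assumes "c 0 = 1"
    and "\<And>k. 1 \<le> k \<Longrightarrow> k \<le> N \<Longrightarrow> real k * c k = (\<Sum>i<k. c i * r (k - i))"
    and "k \<le> N"
  shows "c k = exp_coeff r k"
  using assms(3)
proof (induction k rule: less_induct)
  case (less k)
  show ?case
  proof (cases "k = 0")
    case False
    have "real k * c k = (\<Sum>i<k. exp_coeff r i * r (k - i))"
      using assms(2)[of k] False less by (auto intro!: sum.cong)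
    also have "\<dots> = real k * exp_coeff r k"
      by (simp add: exp_coeff_rec)
    finally show ?thesis using False by simp
  qed (use assms(1) in simp)
qed

lemma exp_coeff_nonneg:
  assumes "\<And>j. 0 \<le> r j"
  shows "0 \<le> exp_coeff r k"
proof (induction k rule: less_induct)
  case (less k)
  then have "0 \<le> real k * exp_coeff r k"
    unfolding exp_coeff_rec by (auto intro!: sum_nonneg mult_nonneg_nonneg assms)
  then show ?case
    by (cases "k = 0") (auto simp: zero_le_mult_iff)
qed

lemma suminf_swap_ennreal:
  fixes f :: "nat \<Rightarrow> nat \<Rightarrow> ennreal"
  shows "(\<Sum>i. \<Sum>j. f i j) = (\<Sum>j. \<Sum>i. f i j)"
  using nn_integral_suminf[of "\<lambda>j i. f i j" "count_space UNIV"]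
  by (simp add: nn_integral_count_space_nat)

lemma fps_power_nth_sums:
  fixes L :: "real fps"
  assumes "\<And>k. 0 \<le> L $ k" and "summable (\<lambda>k. L $ k)"
  shows "(\<lambda>k. (L ^ m) $ k) sums (\<Sum>k. L $ k) ^ m \<and> (\<forall>k. 0 \<le> (L ^ m) $ k)"
proof (induction m)
  case 0
  have "(\<lambda>k. if k = 0 then 1 else 0 :: real) sums 1"
    using sums_single[of 0 "\<lambda>_. 1::real"] by simp
  then show ?case by (simp add: fps_one_nth)
next
  case (Suc m)
  have "(\<lambda>k. \<Sum>i\<le>k. L $ i * (L ^ m) $ (k - i)) sums ((\<Sum>k. L $ k) * (\<Sum>k. (L ^ m) $ k))"
    using Suc assms by (intro Cauchy_product_sums) (auto simp: sums_iff)
  then show ?case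
    using Suc assms by (auto simp: fps_mult_nth atLeast0AtMost sums_iff intro!: sum_nonneg mult_nonneg_nonneg)
qed

text \<open>This is the exponential series at \<open>z = 1\<close>. With nonnegative terms the sums
  over powers and over coefficients may be interchanged in \<open>ennreal\<close>, and summability
  of the coefficients follows from the finite value.\<close>

lemma exp_coeff_sums:
  assumes r: "\<And>j. 0 \<le> r j" and s: "summable (\<lambda>j. r j / real j)"
  shows "exp_coeff r sums exp (\<Sum>j. r j / real j)"
proof -
  define L where "L = Abs_fps (\<lambda>j. r j / real j)"
  define l where "l = (\<Sum>j. r j / real j)"
  have L: "(\<lambda>k. (L ^ m) $ k) sums l ^ m" "\<And>k. 0 \<le> (L ^ m) $ k" for m
    using fps_power_nth_sums[of L m] assms by (auto simp: L_def l_def)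
  have "0 \<le> l" unfolding l_def using s r by (intro suminf_nonneg) auto
  have c: "ennreal (exp_coeff r k) = (\<Sum>m. ennreal ((L ^ m) $ k / fact m))" for k
  proof -
    \<comment> \<open>\<open>L ^ m\<close> starts at degree \<open>m\<close>, so only powers up to
      \<open>k\<close> contribute to the \<open>k\<close>-th coefficient.\<close>
    have "(\<Sum>m. ennreal ((L ^ m) $ k / fact m)) = (\<Sum>m\<in>{0..k}. ennreal ((L ^ m) $ k / fact m))"
      by (rule suminf_finite)
        (use startsby_zero_power_prefix[of L] in \<open>auto simp: L_def not_le\<close>)
    also have "\<dots> = ennreal (\<Sum>m\<in>{0..k}. (L ^ m) $ k / fact m)"
      using L by (intro sum_ennreal) auto
    finally show ?thesis
      by (simp add: exp_coeff_def fps_compose_nth L_def field_simps)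
  qed
  have "(\<Sum>k. ennreal (exp_coeff r k)) = (\<Sum>m. \<Sum>k. ennreal ((L ^ m) $ k / fact m))"
    unfolding c by (rule suminf_swap_ennreal)
  also have "\<dots> = (\<Sum>m. ennreal (l ^ m / fact m))"
    using L by (intro suminf_cong suminf_ennreal_eq sums_divide) auto
  also have "\<dots> = ennreal (exp l)"
    using exp_converges[of l] \<open>0 \<le> l\<close>
    by (intro suminf_ennreal_eq) (auto simp: field_simps)
  finally have e: "(\<Sum>k. ennreal (exp_coeff r k)) = ennreal (exp l)" .
  have "summable (exp_coeff r)"
    using e exp_coeff_nonneg[of r, OF r] by (intro summable_suminf_not_top) auto
  moreover have "(\<Sum>k. exp_coeff r k) = exp l"
    using e calculation exp_coeff_nonneg[of r, OF r]
    by (subst (asm) suminf_ennreal2) (auto simp: suminf_nonneg)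
  ultimately show ?thesis by (auto simp: sums_iff l_def)
qed

subsection \<open>Future minima and cyclic rotations of a path\<close>

definition psum :: "(nat \<Rightarrow> real) \<Rightarrow> nat \<Rightarrow> real" where
  "psum x k = (\<Sum>i<k. x i)"

definition stays_nonneg :: "nat \<Rightarrow> (nat \<Rightarrow> real) \<Rightarrow> bool" where
  "stays_nonneg n x \<longleftrightarrow> (\<forall>k\<le>n. 0 \<le> psum x k)"

definition future_min :: "nat \<Rightarrow> (nat \<Rightarrow> real) \<Rightarrow> nat \<Rightarrow> bool" where
  "future_min n x j \<longleftrightarrow> (\<forall>l. j \<le> l \<and> l \<le> n \<longrightarrow> psum x j \<le> psum x l)"

text \<open>Ties are resolved by comparing strictly with the past and, in \<open>future_min\<close>,
  weakly with the future. Position \<open>0\<close> is left out of the strict comparison because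
  \<open>psum x j = 0\<close> must be allowed.\<close>

definition strict_min_end :: "nat \<Rightarrow> (nat \<Rightarrow> real) \<Rightarrow> bool" where
  "strict_min_end j x \<longleftrightarrow> 0 \<le> psum x j \<and> (\<forall>i. 1 \<le> i \<and> i < j \<longrightarrow> psum x j < psum x i)"

lemma psum_shift: "psum (\<lambda>i. x (j + i)) k = psum x (j + k) - psum x j"
  by (induction k) (auto simp: psum_def)

lemma psum_cong: "(\<And>i. i < k \<Longrightarrow> x i = y i) \<Longrightarrow> psum x k = psum y k"
  by (simp add: psum_def)

lemma future_min_end: "future_min n x n"
  by (auto simp: future_min_def)

text \<open>A position before the first future minimum \<open>j\<close> is undercut later; following the
  undercutting positions until they reach \<open>j\<close> shows that it lies strictly above \<open>j\<close>.\<close>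

lemma first_future_min_iff:
  assumes "1 \<le> j" "j \<le> n"
  shows "stays_nonneg n x \<and> future_min n x j \<and> (\<forall>i. 1 \<le> i \<and> i < j \<longrightarrow> \<not> future_min n x i)
    \<longleftrightarrow> strict_min_end j x \<and> stays_nonneg (n - j) (\<lambda>i. x (j + i))" (is "?L \<longleftrightarrow> ?R")
proof
  assume L: ?L
  have "psum x j < psum x i" if i: "1 \<le> i" "i < j" for i
    using i
  proof (induction "j - i" arbitrary: i rule: less_induct)
    case less
    from L less.prems obtain l where l: "i \<le> l" "l \<le> n" "psum x l < psum x i"
      by (auto simp: future_min_def not_le)
    then have "i < l" by (cases "i = l") auto
    show ?case
    proof (cases "l < j")
      case True
      with less.hyps[of l] less.prems \<open>i < l\<close> have "psum x j < psum x l" by auto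
      with l show ?thesis by simp
    next
      case False
      with L l have "psum x j \<le> psum x l" by (auto simp: future_min_def)
      with l show ?thesis by simp
    qed
  qed
  moreover have "0 \<le> psum x j" using L assms by (auto simp: stays_nonneg_def)
  moreover have "stays_nonneg (n - j) (\<lambda>i. x (j + i))"
    using L assms by (auto simp: stays_nonneg_def psum_shift future_min_def)
  ultimately show ?R by (auto simp: strict_min_end_def)
next
  assume R: ?R
  have f: "psum x j \<le> psum x l" if "j \<le> l" "l \<le> n" for l
    using R that le_add_diff_inverse[of j l] diff_le_mono[of l n j]
    unfolding stays_nonneg_def psum_shift by (metis diff_ge_0_iff_ge)
  have "0 \<le> psum x k" if "k \<le> n" for k
  proof -
    consider "k = 0" | "1 \<le> k" "k < j" | "j \<le> k" by linarith
    then show ?thesis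
      using R f[of k] that by cases (auto simp: strict_min_end_def psum_def[of _ 0] intro: less_imp_le order_trans)
  qed
  moreover have "\<not> future_min n x i" if "1 \<le> i" "i < j" for i
    using R that assms by (auto simp: strict_min_end_def future_min_def not_le intro!: exI[of _ j])
  ultimately show ?L
    using f by (auto simp: stays_nonneg_def future_min_def)
qed

lemma ex_first_future_min:
  assumes "1 \<le> n"
  obtains j where "1 \<le> j" "j \<le> n" "future_min n x j" "\<forall>i. 1 \<le> i \<and> i < j \<longrightarrow> \<not> future_min n x i"
proof -
  define j where "j = (LEAST j. 1 \<le> j \<and> future_min n x j)"
  have n: "1 \<le> n \<and> future_min n x n" using assms future_min_end by auto
  have "1 \<le> j \<and> future_min n x j" unfolding j_def by (rule LeastI[of _ n]) (rule n)
  moreover have "j \<le> n" unfolding j_def by (rule Least_le) (rule n)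
  moreover have "\<forall>i. 1 \<le> i \<and> i < j \<longrightarrow> \<not> future_min n x i"
    unfolding j_def using not_less_Least by blast
  ultimately show ?thesis using that by auto
qed

definition rotate_path :: "nat \<Rightarrow> nat \<Rightarrow> (nat \<Rightarrow> real) \<Rightarrow> nat \<Rightarrow> real" where
  "rotate_path n r x k = x ((r + k) mod n)"

lemma psum_periodic:
  "psum (\<lambda>k. x (k mod n)) (l + n * q) = psum (\<lambda>k. x (k mod n)) l + real q * psum x n"
proof -
  have 1: "psum (\<lambda>k. x (k mod n)) (n + l) = psum x n + psum (\<lambda>k. x (k mod n)) l" for l
    using psum_shift[of "\<lambda>k. x (k mod n)" n l] psum_cong[of n "\<lambda>k. x (k mod n)" x] by simp
  show ?thesis
  proof (induction q)
    case (Suc q)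
    then show ?case using 1[of "l + n * q"] by (simp add: algebra_simps)
  qed simp
qed

text \<open>The rotation starting at \<open>n - i\<close> is good at \<open>i\<close> iff \<open>n - i\<close> is the last position in \<open>{1..n}\<close>
  that is minimal among all later positions of the periodic extension; so exactly one \<open>i\<close> works.\<close>

lemma ex1_rotation:
  assumes n: "0 < n"
  defines "good \<equiv> \<lambda>i y. stays_nonneg n y \<and> (\<forall>j. 1 \<le> j \<and> j \<le> i \<longrightarrow> \<not> future_min n y j)"
  shows "0 \<le> psum x n \<Longrightarrow> \<exists>i<n. good i (rotate_path n (n - i) x)"
    and "i < n \<Longrightarrow> good i (rotate_path n (n - i) x) \<Longrightarrow> 0 \<le> psum x n"
    and "i < i' \<Longrightarrow> i' < n \<Longrightarrow> good i (rotate_path n (n - i) x) \<Longrightarrow> \<not> good i' (rotate_path n (n - i') x)"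
proof -
  define T where "T = psum (\<lambda>k. x (k mod n))"
  define s where "s = psum x n"
  define lad where "lad q \<longleftrightarrow> (\<forall>l\<ge>q. T q \<le> T l)" for q
  have per: "T (l + n * q) = T l + real q * s" for l q
    unfolding T_def s_def by (rule psum_periodic)
  have rot: "psum (rotate_path n r x) k = T (r + k) - T r" for r k
    unfolding T_def rotate_path_def using psum_shift[of "\<lambda>k. x (k mod n)" r k] by simp
  have s_iff: "0 \<le> s" if "stays_nonneg n (rotate_path n r x)" for r
  proof -
    have "0 \<le> T (r + n) - T r" using that rot[of r n] by (auto simp: stays_nonneg_def)
    then show ?thesis using per[of r 1] by simp
  qed
  \<comment> \<open>When the period sum is nonnegative, later copies of a position are never lower,
    so one period decides.\<close>
  have ladI: "lad q" if "\<And>l. q \<le> l \<Longrightarrow> l < q + n \<Longrightarrow> T q \<le> T l" "0 \<le> s" for q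
    unfolding lad_def
  proof safe
    fix l assume "q \<le> l"
    define d where "d = l - q"
    have l: "l = (q + d mod n) + n * (d div n)"
      using \<open>q \<le> l\<close> by (simp add: d_def algebra_simps flip: mult.commute)
    have "T q \<le> T (q + d mod n)" using n by (intro that) auto
    also have "\<dots> \<le> T l" unfolding l per[of "q + d mod n"] using that(2) by auto
    finally show "T q \<le> T l" .
  qed
  have good_iff: "good i (rotate_path n (n - i) x) \<longleftrightarrow>
      0 \<le> s \<and> lad (n - i) \<and> (\<forall>q. n - i < q \<and> q \<le> n \<longrightarrow> \<not> lad q)" if i: "i < n" for i
  proof (cases "stays_nonneg n (rotate_path n (n - i) x)")
    case True
    note s = s_iff[OF True]
    have r: "T (n - i) \<le> T l" if "n - i \<le> l" "l \<le> n - i + n" for l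
    proof -
      have "0 \<le> T ((n - i) + (l - (n - i))) - T (n - i)"
        unfolding rot[symmetric] using True that by (auto simp: stays_nonneg_def)
      then show ?thesis using that by simp
    qed
    have lad: "lad (n - i)" using r s by (intro ladI) auto
    have "future_min n (rotate_path n (n - i) x) j \<longleftrightarrow> lad (n - i + j)" if j: "j \<le> n" for j
    proof
      assume f: "future_min n (rotate_path n (n - i) x) j"
      show "lad (n - i + j)"
      proof (rule ladI[OF _ s])
        fix l assume l: "n - i + j \<le> l"
        show "T (n - i + j) \<le> T l"
        proof (cases "l \<le> n - i + n")
          case True
          define d where "d = l - (n - i)"
          have d: "l = n - i + d" "j \<le> d" "d \<le> n" using l True by (auto simp: d_def)
          then show ?thesis
            using f[unfolded future_min_def, rule_format, of d] by (simp add: rot)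
        next
          case False
          \<comment> \<open>\<open>future_min n\<close> sees only the window ending at
            \<open>n - i + n\<close>; beyond it, go back one period and use the minimality of the
            starting point \<open>n - i\<close>.\<close>
          have "T (n - i + j) \<le> T (n - i + n)"
            using f[unfolded future_min_def, rule_format, of n] j by (auto simp: rot)
          also have "\<dots> = T (n - i) + s" using per[of "n - i" 1] by simp
          also have "\<dots> \<le> T (l - n) + s"
            using lad False by (auto simp: lad_def)
          also have "\<dots> = T l" using per[of "l - n" 1] False by simp
          finally show ?thesis .
        qed
      qed
    next
      assume "lad (n - i + j)"
      then show "future_min n (rotate_path n (n - i) x) j"
        by (auto simp: future_min_def rot lad_def)
    qed
    then have "good i (rotate_path n (n - i) x) \<longleftrightarrow> (\<forall>j. 1 \<le> j \<and> j \<le> i \<longrightarrow> \<not> lad (n - i + j))"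
      using True i unfolding good_def by auto
    also have "\<dots> \<longleftrightarrow> (\<forall>q. n - i < q \<and> q \<le> n \<longrightarrow> \<not> lad q)"
    proof safe
      fix q assume "\<forall>j. 1 \<le> j \<and> j \<le> i \<longrightarrow> \<not> lad (n - i + j)" "n - i < q" "q \<le> n" "lad q"
      then show False using i by (auto dest!: spec[of _ "q - (n - i)"])
    next
      fix j assume "\<forall>q. n - i < q \<and> q \<le> n \<longrightarrow> \<not> lad q" "1 \<le> j" "j \<le> i" "lad (n - i + j)"
      then show False using i by (auto dest!: spec[of _ "n - i + j"])
    qed
    finally show ?thesis using s lad by auto
  next
    case False
    then have "\<not> (0 \<le> s \<and> lad (n - i))"
      by (fastforce simp: stays_nonneg_def rot lad_def)
    then show ?thesis using False by (auto simp: good_def)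
  qed
  {
    assume "0 \<le> psum x n"
    then have s: "0 \<le> s" by (simp add: s_def)
    have "\<exists>q\<in>{..<n}. \<forall>l\<in>{..<n}. T q \<le> T l"
      using n using arg_min_least[of "{..<n}" _ T] arg_min_if_finite(1)[of "{..<n}" T] n by (intro bexI[of _ "arg_min_on T {..<n}"]) auto
    then obtain q where q: "q < n" "\<And>l. l < n \<Longrightarrow> T q \<le> T l" by auto
    have q': "T q \<le> T l" for l
    proof -
      have "T q \<le> T (l mod n)" using n q by auto
      also have "\<dots> \<le> T (l mod n + n * (l div n))" unfolding per using s by auto
      finally show ?thesis by simp
    qed
    then have "lad q" by (auto simp: lad_def)
    \<comment> \<open>Starting points range over \<open>{1..n}\<close>; a minimum found at
      \<open>0\<close> is replaced by its copy at \<open>n\<close>.\<close>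
    have "\<exists>q'. 1 \<le> q' \<and> q' \<le> n \<and> lad q'"
    proof (cases "q = 0")
      case True
      have "lad n"
        unfolding lad_def
      proof safe
        fix l assume "n \<le> l"
        then show "T n \<le> T l" using per[of 0 1] per[of "l - n" 1] q'[of "l - n"] True by simp
      qed
      then show ?thesis using n by (intro exI[of _ n]) auto
    qed (use q \<open>lad q\<close> in \<open>auto intro!: exI[of _ q]\<close>)
    then obtain q1 where q1: "1 \<le> q1" "q1 \<le> n" "lad q1" by auto
    define r where "r = (GREATEST r. r \<le> n \<and> lad r)"
    have r: "r \<le> n \<and> lad r"
      unfolding r_def by (rule GreatestI_nat[of _ q1 n]) (use q1 in auto)
    have r1: "q' \<le> r" if "q' \<le> n" "lad q'" for q'
      unfolding r_def by (rule Greatest_le_nat[of _ _ n]) (use that in auto)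
    then have "1 \<le> r" using q1 by force
    then show "\<exists>i<n. good i (rotate_path n (n - i) x)"
      using r r1 s good_iff[of "n - r"] n by (intro exI[of _ "n - r"]) (auto simp: not_less[symmetric])
  }
  {
    assume "i < n" "good i (rotate_path n (n - i) x)"
    then show "0 \<le> psum x n" using good_iff by (auto simp: s_def)
  }
  {
    assume "i < i'" "i' < n" "good i (rotate_path n (n - i) x)"
    then show "\<not> good i' (rotate_path n (n - i') x)" using good_iff[of i] good_iff[of i'] by auto
  }
qed

subsection \<open>The Sparre Andersen identity\<close>

lemma (in prob_space) indep_vars_reindex_inj:
  assumes X: "indep_vars (\<lambda>_. N) X UNIV" and \<pi>: "inj \<pi>"
  shows "indep_vars (\<lambda>_. N) (\<lambda>i. X (\<pi> i)) UNIV"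
  unfolding indep_vars_def2
proof (intro conjI indep_setsI)
  show "\<forall>i\<in>UNIV. random_variable N (X (\<pi> i))"
    using X by (auto simp: indep_vars_def2)
  then show "{X (\<pi> i) -` A \<inter> space M |A. A \<in> sets N} \<subseteq> events" for i
    by (auto intro: measurable_sets)
  fix A J assume J: "J \<subseteq> UNIV" "J \<noteq> {}" "finite J"
    and A: "\<forall>j\<in>J. A j \<in> {X (\<pi> j) -` B \<inter> space M |B. B \<in> sets N}"
  have "prob (\<Inter>j\<in>\<pi> ` J. A (inv \<pi> j)) = (\<Prod>j\<in>\<pi> ` J. prob (A (inv \<pi> j)))"
    using X J A \<pi> unfolding indep_vars_def2
    by (intro indep_setsD[where I=UNIV and F="\<lambda>i. {X i -` B \<inter> space M |B. B \<in> sets N}"]) auto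
  then show "prob (\<Inter>j\<in>J. A j) = (\<Prod>j\<in>J. prob (A j))"
    using \<pi> by (simp add: prod.reindex inj_on_subset[OF \<pi>])
qed

locale iid_sequence = prob_space M for M :: "'a measure" +
  fixes Z :: "nat \<Rightarrow> 'a \<Rightarrow> real"
  assumes indep: "indep_vars (\<lambda>_. borel) Z UNIV"
    and ident: "\<And>i. distr M borel (Z i) = distr M borel (Z 0)"
begin

abbreviation seq_space :: "(nat \<Rightarrow> real) measure" where
  "seq_space \<equiv> PiM UNIV (\<lambda>_. borel)"

definition path_prob :: "((nat \<Rightarrow> real) \<Rightarrow> bool) \<Rightarrow> real" where
  "path_prob Q = prob {\<omega> \<in> space M. Q (\<lambda>i. Z i \<omega>)}"

lemma Z_measurable [measurable]: "random_variable borel (Z i)"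
  using indep by (auto simp: indep_vars_def)

lemma path_measurable [measurable]: "(\<lambda>\<omega> i. Z (\<pi> i) \<omega>) \<in> M \<rightarrow>\<^sub>M seq_space"
  by (rule measurable_PiM_single') auto

lemma psum_measurable [measurable]: "(\<lambda>x. psum x k) \<in> borel_measurable seq_space"
  unfolding psum_def by measurable

lemma stays_nonneg_measurable [measurable]: "Measurable.pred seq_space (stays_nonneg n)"
  unfolding stays_nonneg_def[abs_def] by measurable

lemma future_min_measurable [measurable]: "Measurable.pred seq_space (\<lambda>x. future_min n x j)"
  unfolding future_min_def[abs_def]
  by (intro pred_intros_countable pred_intros_imp')
    (unfold pred_def, intro borel_measurable_le psum_measurable)

lemma strict_min_end_measurable [measurable]: "Measurable.pred seq_space (strict_min_end j)"
  unfolding strict_min_end_def[abs_def]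
  by (intro pred_intros_logic pred_intros_countable pred_intros_imp') measurable

lemma path_event [measurable]:
  assumes [measurable]: "Measurable.pred seq_space Q"
  shows "{\<omega> \<in> space M. Q (\<lambda>i. Z (\<pi> i) \<omega>)} \<in> events"
  by measurable

text \<open>Independence and equal marginals make the joint law a product of identical factors, so
  an injective reindexing leaves it unchanged. It is needed for shifts and for cyclic
  rotations.\<close>

lemma law_reindex:
  assumes "inj \<pi>"
  shows "distr M seq_space (\<lambda>\<omega> i. Z (\<pi> i) \<omega>) = PiM UNIV (\<lambda>_. distr M borel (Z 0))"
proof -
  have "indep_vars (\<lambda>_. borel) (\<lambda>i. Z (\<pi> i)) UNIV"
    using indep assms by (rule indep_vars_reindex_inj)
  then have "distr M seq_space (\<lambda>\<omega>. \<lambda>i\<in>UNIV. Z (\<pi> i) \<omega>) = PiM UNIV (\<lambda>i. distr M borel (Z (\<pi> i)))"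
    by (subst (asm) indep_vars_iff_distr_eq_PiM) auto
  also have "\<dots> = PiM UNIV (\<lambda>_. distr M borel (Z 0))"
    using ident by (intro PiM_cong) auto
  finally show ?thesis by (simp add: restrict_def)
qed

lemma path_prob_reindex:
  assumes "inj \<pi>" and [measurable]: "Measurable.pred seq_space Q"
  shows "prob {\<omega> \<in> space M. Q (\<lambda>i. Z (\<pi> i) \<omega>)} = path_prob Q"
proof -
  have "prob {\<omega> \<in> space M. Q (\<lambda>i. Z (\<pi> i) \<omega>)}
      = measure (distr M seq_space (\<lambda>\<omega> i. Z (\<pi> i) \<omega>)) {x \<in> space seq_space. Q x}" if "inj \<pi>" for \<pi>
  proof -
    have "{x \<in> space seq_space. Q x} \<in> sets seq_space" by measurable
    then show ?thesis
      by (subst measure_distr) (measurable, auto intro!: arg_cong[where f=prob] simp: space_PiM)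
  qed
  from this[OF assms(1)] this[of id] show ?thesis
    unfolding path_prob_def law_reindex[OF assms(1)] using law_reindex[of id] by simp
qed

lemma path_prob_split:
  assumes [measurable]: "Measurable.pred seq_space Q1" "Measurable.pred seq_space Q2"
    and loc: "\<And>x y. (\<And>i. i < j \<Longrightarrow> x i = y i) \<Longrightarrow> Q1 x = Q1 y"
  shows "path_prob (\<lambda>x. Q1 x \<and> Q2 (\<lambda>i. x (j + i))) = path_prob Q1 * path_prob Q2"
proof -
  let ?A = "PiM {..<j} (\<lambda>_. borel :: real measure)" and ?B = "PiM {j..} (\<lambda>_. borel :: real measure)"
  let ?XA = "\<lambda>\<omega>. \<lambda>i\<in>{..<j}. Z i \<omega>" and ?XB = "\<lambda>\<omega>. \<lambda>i\<in>{j..}. Z i \<omega>"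
  have iv: "indep_var ?A ?XA ?B ?XB"
    by (rule indep_var_restrict[OF indep]) auto
  \<comment> \<open>\<open>Q1\<close> takes a whole sequence but depends on the first
    \<open>j\<close> entries only; filling up with \<open>0\<close> turns it into an event of the
    first block.\<close>
  have mA [measurable]: "(\<lambda>x i. if i < j then x i else 0) \<in> ?A \<rightarrow>\<^sub>M seq_space"
  proof (rule measurable_PiM_single')
    fix i show "(\<lambda>x. if i < j then x i else 0) \<in> borel_measurable ?A"
      by (cases "i < j") auto
  qed auto
  have mB [measurable]: "(\<lambda>x i. x (j + i)) \<in> ?B \<rightarrow>\<^sub>M seq_space"
    by (rule measurable_PiM_single') auto
  define SA where "SA = {x \<in> space ?A. Q1 (\<lambda>i. if i < j then x i else 0)}"
  define SB where "SB = {x \<in> space ?B. Q2 (\<lambda>i. x (j + i))}"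
  have S: "SA \<in> sets ?A" "SB \<in> sets ?B" unfolding SA_def SB_def by measurable
  have Q1: "Q1 (\<lambda>i. if i < j then ?XA \<omega> i else 0) \<longleftrightarrow> Q1 (\<lambda>i. Z i \<omega>)" for \<omega>
    by (rule loc) auto
  have a: "?XA -` SA \<inter> space M = {\<omega> \<in> space M. Q1 (\<lambda>i. Z i \<omega>)}"
    using Q1 by (auto simp: SA_def space_PiM PiE_iff)
  have b: "?XB -` SB \<inter> space M = {\<omega> \<in> space M. Q2 (\<lambda>i. Z (j + i) \<omega>)}"
    by (auto simp: SB_def space_PiM PiE_iff)
  have ab: "(\<lambda>\<omega>. (?XA \<omega>, ?XB \<omega>)) -` (SA \<times> SB) \<inter> space M
      = (?XA -` SA \<inter> space M) \<inter> (?XB -` SB \<inter> space M)"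
    by auto
  have "path_prob (\<lambda>x. Q1 x \<and> Q2 (\<lambda>i. x (j + i)))
      = prob ((\<lambda>\<omega>. (?XA \<omega>, ?XB \<omega>)) -` (SA \<times> SB) \<inter> space M)"
    unfolding ab a b path_prob_def by (rule arg_cong[where f=prob]) auto
  also have "\<dots> = prob {\<omega> \<in> space M. Q1 (\<lambda>i. Z i \<omega>)} * prob {\<omega> \<in> space M. Q2 (\<lambda>i. Z (j + i) \<omega>)}"
    unfolding indep_varD[OF iv S] a b ..
  also have "prob {\<omega> \<in> space M. Q2 (\<lambda>i. Z (j + i) \<omega>)} = path_prob Q2"
    by (rule path_prob_reindex) auto
  finally show ?thesis by (simp add: path_prob_def)
qed

section \<open>Renewal equations from the first future minimum\<close>

definition persist :: "nat \<Rightarrow> real" where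
  "persist n = path_prob (stays_nonneg n)"

definition above :: "nat \<Rightarrow> real" where
  "above n = path_prob (\<lambda>x. 0 \<le> psum x n)"

text \<open>Read backwards from \<open>j\<close>, the event says that the reversed walk is negative
  at times \<open>1, ..., j - 1\<close> and nonnegative at \<open>j\<close>. So this is the law of
  the first weak ascending ladder epoch.\<close>

definition ladder :: "nat \<Rightarrow> real" where
  "ladder j = path_prob (strict_min_end j)"

lemma persist_0 [simp]: "persist 0 = 1"
  by (simp add: persist_def path_prob_def stays_nonneg_def psum_def prob_space)

text \<open>The event is partitioned by the first future minimum \<open>j > i\<close>;
  \<open>first_future_min_iff\<close> factorises each piece at time \<open>j\<close>. The case
  \<open>i = 0\<close> is the renewal equation, and summing over \<open>i\<close> will produce the
  weights \<open>j\<close>.\<close>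

lemma prob_late_future_min:
  assumes "i < n"
  shows "path_prob (\<lambda>x. stays_nonneg n x \<and> (\<forall>j. 1 \<le> j \<and> j \<le> i \<longrightarrow> \<not> future_min n x j))
    = (\<Sum>j\<in>{i<..n}. ladder j * persist (n - j))"
proof -
  define W where "W j = (\<lambda>x. stays_nonneg n x \<and> future_min n x j
      \<and> (\<forall>i. 1 \<le> i \<and> i < j \<longrightarrow> \<not> future_min n x i))" for j
  have [measurable]: "Measurable.pred seq_space (W j)" for j
    unfolding W_def by (intro pred_intros_logic pred_intros_countable pred_intros_imp') measurable
  have W: "path_prob (W j) = ladder j * persist (n - j)" if "j \<in> {i<..n}" for j
  proof -
    have "path_prob (W j) = path_prob (\<lambda>x. strict_min_end j x \<and> stays_nonneg (n - j) (\<lambda>i. x (j + i)))"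
      using that unfolding W_def by (intro arg_cong[where f=path_prob] ext first_future_min_iff) auto
    also have "\<dots> = ladder j * persist (n - j)"
      unfolding ladder_def persist_def
    proof (rule path_prob_split)
      fix x y :: "nat \<Rightarrow> real" assume "\<And>i. i < j \<Longrightarrow> x i = y i"
      then have "psum x k = psum y k" if "k \<le> j" for k
        using that by (intro psum_cong) auto
      then show "strict_min_end j x = strict_min_end j y"
        by (auto simp: strict_min_end_def)
    qed auto
    finally show ?thesis .
  qed
  have "{\<omega> \<in> space M. stays_nonneg n (\<lambda>i. Z i \<omega>)
        \<and> (\<forall>j. 1 \<le> j \<and> j \<le> i \<longrightarrow> \<not> future_min n (\<lambda>i. Z i \<omega>) j)}
      = (\<Union>j\<in>{i<..n}. {\<omega> \<in> space M. W j (\<lambda>i. Z i \<omega>)})" (is "?E = ?U")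
  proof (rule set_eqI)
    fix \<omega>
    obtain j where j: "1 \<le> j" "j \<le> n" "future_min n (\<lambda>i. Z i \<omega>) j"
      "\<forall>i. 1 \<le> i \<and> i < j \<longrightarrow> \<not> future_min n (\<lambda>i. Z i \<omega>) i"
      using ex_first_future_min[of n "\<lambda>i. Z i \<omega>"] assms by auto
    show "\<omega> \<in> ?E \<longleftrightarrow> \<omega> \<in> ?U"
    proof
      assume E: "\<omega> \<in> ?E"
      then have "i < j" using j by (auto simp: not_less[symmetric])
      then show "\<omega> \<in> ?U" using j E by (auto simp: W_def)
    qed (auto simp: W_def)
  qed
  moreover have "prob ?U = (\<Sum>j\<in>{i<..n}. prob {\<omega> \<in> space M. W j (\<lambda>i. Z i \<omega>)})"
  proof (rule finite_measure_finite_Union)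
    show "disjoint_family_on (\<lambda>j. {\<omega> \<in> space M. W j (\<lambda>i. Z i \<omega>)}) {i<..n}"
      unfolding disjoint_family_on_def
    proof safe
      fix j j' \<omega> assume "j \<in> {i<..n}" "j' \<in> {i<..n}" "j \<noteq> j'" "W j (\<lambda>i. Z i \<omega>)" "W j' (\<lambda>i. Z i \<omega>)"
      then show "\<omega> \<in> {}" by (cases j j' rule: linorder_cases) (auto simp: W_def)
    qed
  qed (auto simp: image_subset_iff)
  ultimately show ?thesis
    using W by (simp add: path_prob_def)
qed

lemma persist_renewal:
  assumes "1 \<le> n"
  shows "persist n = (\<Sum>j\<in>{0<..n}. ladder j * persist (n - j))"
  using prob_late_future_min[of 0 n] assms unfolding persist_def by simp

text \<open>If the walk ends nonnegative, exactly one rotation, labelled by \<open>i < n\<close>,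
  stays nonnegative with its first future minimum after \<open>i\<close>. Rotations preserve the
  law, so the probabilities in \<open>prob_late_future_min\<close> add up over \<open>i\<close>, and
  the term of \<open>j\<close> is counted once for each \<open>i < j\<close>.\<close>

lemma above_renewal:
  assumes n: "1 \<le> n"
  shows "above n = (\<Sum>j\<in>{0<..n}. real j * (ladder j * persist (n - j)))"
proof -
  define w where "w j = ladder j * persist (n - j)" for j
  define G where "G i x \<longleftrightarrow> stays_nonneg n x \<and> (\<forall>j. 1 \<le> j \<and> j \<le> i \<longrightarrow> \<not> future_min n x j)" for i x
  have mG [measurable]: "Measurable.pred seq_space (G i)" for i
    unfolding G_def[abs_def] by (intro pred_intros_logic pred_intros_countable pred_intros_imp') measurable
  have G_cong: "G i x = G i y" if "\<And>k. k < n \<Longrightarrow> x k = y k" "i < n" for i x y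
  proof -
    have "psum x k = psum y k" if "k \<le> n" for k
      using that \<open>\<And>k. k < n \<Longrightarrow> x k = y k\<close> by (intro psum_cong) auto
    then show ?thesis using that(2) by (auto simp: G_def stays_nonneg_def future_min_def)
  qed
  \<comment> \<open>The rotation of the first \<open>n\<close> indices is continued by the identity,
    to be injective on all indices.\<close>
  define \<pi> where "\<pi> r k = (if k < n then (r + k) mod n else k)" for r k
  have inj: "inj (\<pi> r)" for r
  proof (rule injI)
    fix k l assume e: "\<pi> r k = \<pi> r l"
    have *: "k = l" if "k \<le> l" "l < n" "(r + k) mod n = (r + l) mod n" for k l
    proof -
      have "n dvd (r + l) - (r + k)"
        using that by (subst mod_eq_dvd_iff_nat[symmetric]) auto
      then show ?thesis using that by (auto dest: dvd_imp_le)
    qed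
    have "k = l" if "k < n" "l < n" "(r + k) mod n = (r + l) mod n"
      using *[of k l] *[of l k] that by (cases k l rule: le_cases) auto
    moreover have "(r + k) mod n < n" "(r + l) mod n < n" using n by auto
    ultimately show "k = l" using e by (auto simp: \<pi>_def split: if_splits)
  qed
  define E where "E i = {\<omega> \<in> space M. G i (\<lambda>k. Z (\<pi> (n - i) k) \<omega>)}" for i
  have rot: "G i (\<lambda>k. Z (\<pi> r k) \<omega>) = G i (rotate_path n r (\<lambda>k. Z k \<omega>))" if "i < n" for i r \<omega>
    using that by (intro G_cong) (auto simp: \<pi>_def rotate_path_def)
  have "{\<omega> \<in> space M. 0 \<le> psum (\<lambda>i. Z i \<omega>) n} = (\<Union>i<n. E i)"
  proof (rule set_eqI)
    fix \<omega>
    show "\<omega> \<in> {\<omega> \<in> space M. 0 \<le> psum (\<lambda>i. Z i \<omega>) n} \<longleftrightarrow> \<omega> \<in> (\<Union>i<n. E i)"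
      using ex1_rotation(1)[of n "\<lambda>i. Z i \<omega>", folded G_def]
        ex1_rotation(2)[where x="\<lambda>i. Z i \<omega>" and n=n, folded G_def] n rot
      unfolding E_def by auto
  qed
  moreover have "prob (\<Union>i<n. E i) = (\<Sum>i<n. prob (E i))"
  proof (rule finite_measure_finite_Union)
    have "E i \<inter> E i' = {}" if "i < i'" "i' < n" for i i'
      using ex1_rotation(3)[where i=i and i'=i' and n=n, folded G_def] n that rot unfolding E_def by auto
    then show "disjoint_family_on E {..<n}"
      unfolding disjoint_family_on_def by (metis Int_commute lessThan_iff linorder_neqE_nat)
  qed (auto simp: E_def)
  ultimately have "above n = (\<Sum>i<n. prob (E i))" by (simp add: above_def path_prob_def)
  also have "\<dots> = (\<Sum>i<n. path_prob (G i))"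
    unfolding E_def by (intro sum.cong refl path_prob_reindex inj mG)
  also have "\<dots> = (\<Sum>i<n. \<Sum>j\<in>{i<..n}. w j)"
    unfolding G_def[abs_def] w_def by (intro sum.cong refl prob_late_future_min) auto
  also have "\<dots> = (\<Sum>i<n. \<Sum>j\<in>{0<..n}. if i < j then w j else 0)"
    by (intro sum.cong refl sum.mono_neutral_cong_left) auto
  also have "\<dots> = (\<Sum>j\<in>{0<..n}. \<Sum>i<n. if i < j then w j else 0)"
    by (rule sum.swap)
  also have "\<dots> = (\<Sum>j\<in>{0<..n}. \<Sum>i<j. w j)"
    by (intro sum.cong refl sum.mono_neutral_cong_right) auto
  finally show ?thesis by (simp add: w_def)
qed

text \<open>With \<open>B\<close>, \<open>F\<close>, \<open>P\<close> the generating functions of the three sequences the two renewal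
  equations read \<open>B = 1 + F B\<close> and \<open>P = X F' B\<close>, so that \<open>X B' = X F' B\<^sup>2 = B P\<close>.\<close>

lemma persist_rec: "real n * persist n = (\<Sum>k<n. persist k * above (n - k))"
proof -
  define B where "B = Abs_fps persist"
  define F where "F = Abs_fps (\<lambda>j. if j = 0 then 0 else ladder j)"
  define P where "P = Abs_fps (\<lambda>j. if j = 0 then 0 else above j)"
  have BF: "B = 1 + F * B"
  proof (rule fps_ext)
    fix k
    have "(F * B) $ k = (\<Sum>i\<in>{0<..k}. ladder i * persist (k - i))"
      unfolding fps_mult_nth by (intro sum.mono_neutral_cong_right) (auto simp: F_def B_def)
    then show "B $ k = (1 + F * B) $ k"
      using persist_renewal[of k] by (cases "k = 0") (auto simp: B_def)
  qed
  have PF: "P = fps_X * fps_deriv F * B"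
  proof (rule fps_ext)
    fix k
    have X: "(fps_X * fps_deriv F) $ i = (if i = 0 then 0 else real i * ladder i)" for i
      by (cases i) (auto simp: F_def)
    have "(fps_X * fps_deriv F * B) $ k = (\<Sum>i\<in>{0<..k}. real i * (ladder i * persist (k - i)))"
      unfolding fps_mult_nth[of "fps_X * fps_deriv F"] X
      by (intro sum.mono_neutral_cong_right) (auto simp: B_def)
    then show "P $ k = (fps_X * fps_deriv F * B) $ k"
      using above_renewal[of k] by (cases "k = 0") (auto simp: P_def)
  qed
  have "B * (1 - F) = B - F * B" by (simp add: algebra_simps)
  also have "\<dots> = 1" using BF by (metis add_diff_cancel_right')
  finally have 1: "B * (1 - F) = 1" .
  have "fps_deriv (B * (1 - F)) = 0" unfolding 1 by simp
  then have 2: "fps_deriv B * (1 - F) = B * fps_deriv F" by (simp add: mult.commute)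
  have "fps_deriv B = fps_deriv B * (B * (1 - F))" unfolding 1 by simp
  also have "\<dots> = fps_deriv B * (1 - F) * B" by (simp only: mult_ac)
  also have "\<dots> = B * fps_deriv F * B" unfolding 2 ..
  finally have "fps_X * fps_deriv B = B * P" unfolding PF by (simp only: mult_ac)
  then have "(fps_X * fps_deriv B) $ n = (B * P) $ n" by simp
  moreover have "(fps_X * fps_deriv B) $ n = real n * persist n"
    by (cases n) (auto simp: B_def)
  moreover have "(B * P) $ n = (\<Sum>k<n. persist k * above (n - k))"
    unfolding fps_mult_nth by (intro sum.mono_neutral_cong_right) (auto simp: B_def P_def)
  ultimately show ?thesis by simp
qed

lemma persist_eq_exp_coeff: "persist k = exp_coeff above k"
  by (rule exp_coeff_unique[of persist k above k]) (simp_all add: persist_rec)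

end

subsection \<open>A renewal estimate for weights of inverse square root size\<close>

lemma sum_inverse_sqrt_le: "(\<Sum>j\<in>{0<..n}. 1 / sqrt (real j)) \<le> 2 * sqrt (real n)"
proof (induction n)
  case (Suc n)
  have "1 / sqrt (real (Suc n)) \<le> 2 * (sqrt (real (Suc n)) - sqrt (real n))"
  proof -
    define x y where "x = sqrt (real (Suc n))" and "y = sqrt (real n)"
    have xy: "0 < x" "y \<le> x" "x * x - y * y = 1" by (auto simp: x_def y_def)
    have "1 = (x - y) * (x + y)" using xy by (simp add: algebra_simps)
    also have "\<dots> \<le> (x - y) * (2 * x)" using xy by (intro mult_left_mono) auto
    finally show ?thesis using xy unfolding x_def[symmetric] y_def[symmetric] by (simp add: field_simps)
  qed
  moreover have "{0<..Suc n} = insert (Suc n) {0<..n}" by auto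
  ultimately show ?case using Suc by simp
qed simp

text \<open>\<open>h\<close> will be \<open>a^2\<close> and \<open>r\<close> the tilted weights. The
  plain bound \<open>A\<close> takes over for \<open>j * h < 1\<close>, where the square root bound
  is weaker. Every estimate below is explicit so that it holds uniformly in
  \<open>a\<close>.\<close>

locale inverse_sqrt_weights =
  fixes r :: "nat \<Rightarrow> real" and A h :: real
  assumes A: "1 \<le> A" and h: "0 < h" and r_nonneg: "\<And>j. 0 \<le> r j" and r_le: "\<And>j. r j \<le> A"
    and r_le_sqrt: "\<And>j. 1 \<le> j \<Longrightarrow> r j \<le> A / sqrt (real j * h)"
    and r_summable: "summable (\<lambda>j. r j / real j)"
begin

abbreviation c where "c \<equiv> exp_coeff r"
definition total where "total = exp (\<Sum>j. r j / real j)"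

lemma c_nonneg: "0 \<le> c k" by (rule exp_coeff_nonneg) (rule r_nonneg)

lemma c_sums: "c sums total"
  unfolding total_def by (rule exp_coeff_sums[OF r_nonneg r_summable])

lemma total_pos: "0 < total" by (simp add: total_def)

lemma sum_c_le: "finite I \<Longrightarrow> sum c I \<le> total"
  using sum_le_suminf[of c I] c_sums c_nonneg by (auto simp: sums_iff)

lemma sum_r_le: "(\<Sum>j\<in>{0<..n}. r j) \<le> 2 * A * sqrt (real n) / sqrt h"
proof -
  have "(\<Sum>j\<in>{0<..n}. r j) \<le> (\<Sum>j\<in>{0<..n}. A / sqrt h * (1 / sqrt (real j)))"
    using r_le_sqrt h by (intro sum_mono) (auto simp: real_sqrt_mult mult.commute)
  also have "\<dots> = A / sqrt h * (\<Sum>j\<in>{0<..n}. 1 / sqrt (real j))" by (simp add: sum_distrib_left)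
  also have "\<dots> \<le> A / sqrt h * (2 * sqrt (real n))"
    using A h by (intro mult_left_mono sum_inverse_sqrt_le) auto
  finally show ?thesis by (simp add: mult_ac)
qed

text \<open>Summing the recursion over \<open>k\<close> and exchanging the sums gives each
  \<open>c i\<close> a partial sum of \<open>r\<close> as its factor.\<close>

lemma sum_moment_le: "(\<Sum>k\<in>{0<..n}. real k * c k) \<le> total * (\<Sum>j\<in>{0<..n}. r j)"
proof -
  have "(\<Sum>k\<in>{0<..n}. real k * c k) = (\<Sum>k\<in>{0<..n}. \<Sum>i<n. if i < k then c i * r (k - i) else 0)"
    unfolding exp_coeff_rec by (intro sum.cong refl sum.mono_neutral_cong_left) auto
  also have "\<dots> = (\<Sum>i<n. \<Sum>k\<in>{0<..n}. if i < k then c i * r (k - i) else 0)"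
    by (rule sum.swap)
  also have "\<dots> \<le> (\<Sum>i<n. c i * (\<Sum>j\<in>{0<..n}. r j))"
  proof (rule sum_mono)
    fix i assume "i \<in> {..<n}"
    have "(\<Sum>k\<in>{0<..n}. if i < k then c i * r (k - i) else 0) = (\<Sum>k\<in>{i<..n}. c i * r (k - i))"
      by (intro sum.mono_neutral_cong_right) auto
    also have "\<dots> = c i * (\<Sum>j\<in>{0<..n - i}. r j)"
      unfolding sum_distrib_left
      by (rule sum.reindex_bij_witness[of _ "\<lambda>j. i + j" "\<lambda>k. k - i"]) auto
    also have "\<dots> \<le> c i * (\<Sum>j\<in>{0<..n}. r j)"
      using c_nonneg r_nonneg by (intro mult_left_mono sum_mono2) auto
    finally show "(\<Sum>k\<in>{0<..n}. if i < k then c i * r (k - i) else 0) \<le> c i * (\<Sum>j\<in>{0<..n}. r j)" .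
  qed
  also have "\<dots> = sum c {..<n} * (\<Sum>j\<in>{0<..n}. r j)" by (simp add: sum_distrib_right)
  also have "\<dots> \<le> total * (\<Sum>j\<in>{0<..n}. r j)"
    using r_nonneg by (intro mult_right_mono sum_c_le sum_nonneg) auto
  finally show ?thesis .
qed

text \<open>A Markov inequality: \<open>k\<close> exceeds \<open>m\<close> on the block, while the
  first moment truncated at \<open>2 * m\<close> is of order
  \<open>total * sqrt (m / h)\<close>.\<close>

lemma dyadic_block_le:
  assumes "1 \<le> m"
  shows "(\<Sum>k\<in>{m<..2 * m}. c k) \<le> 2 * sqrt 2 * A * total / sqrt (real m * h)"
proof -
  have "real m * (\<Sum>k\<in>{m<..2 * m}. c k) \<le> (\<Sum>k\<in>{m<..2 * m}. real k * c k)"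
    unfolding sum_distrib_left using c_nonneg by (intro sum_mono mult_right_mono) auto
  also have "\<dots> \<le> (\<Sum>k\<in>{0<..2 * m}. real k * c k)"
    using c_nonneg by (intro sum_mono2) auto
  also have "\<dots> \<le> total * (\<Sum>j\<in>{0<..2 * m}. r j)" by (rule sum_moment_le)
  also have "\<dots> \<le> total * (2 * A * sqrt (real (2 * m)) / sqrt h)"
    using total_pos by (intro mult_left_mono sum_r_le) auto
  also have "\<dots> = real m * (2 * sqrt 2 * A * total / sqrt (real m * h))"
  proof -
    have "sqrt (real m) * sqrt (real m) = real m" by simp
    then have "sqrt (real m) = real m / sqrt (real m)" using assms by (simp add: field_simps)
    then show ?thesis using h assms by (simp add: real_sqrt_mult field_simps)
  qed
  finally show ?thesis by (rule mult_left_le_imp_le) (use assms in simp)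
qed

lemma tail_le:
  assumes "1 \<le> m"
  shows "(\<Sum>k\<in>{m<..n}. c k) \<le> 10 * A * total / sqrt (real m * h)"
  using assms
proof (induction "n - m" arbitrary: m rule: less_induct)
  case less
  have s: "sqrt 2 \<le> (71/50 :: real)"
    by (rule real_le_lsqrt) (simp_all add: power2_eq_square)
  \<comment> \<open>\<open>10\<close> is a convenient \<open>K\<close> with
    \<open>2 * sqrt 2 + K / sqrt 2 <= K\<close>, as needed to add the block
    \<open>{m<..2 * m}\<close> to the bound at \<open>2 * m\<close>. Using
    \<open>sqrt 2 <= 3/2\<close> here would be too weak, hence \<open>71/50\<close>.\<close>
  have num: "2 * sqrt 2 + 10 / sqrt 2 \<le> (10 :: real)"
  proof -
    have "10 / sqrt 2 = 5 * sqrt (2::real)"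
      using real_sqrt_mult_self[of 2] by (simp add: field_simps)
    then show ?thesis using s by linarith
  qed
  define B where "B = A * total / sqrt (real m * h)"
  have B: "0 \<le> B" using A total_pos h by (simp add: B_def)
  show ?case
  proof (cases "m < n")
    case True
    have "(\<Sum>k\<in>{m<..n}. c k) \<le> (\<Sum>k\<in>{m<..2 * m} \<union> {2 * m<..n}. c k)"
      using c_nonneg by (intro sum_mono2) auto
    also have "\<dots> = (\<Sum>k\<in>{m<..2 * m}. c k) + (\<Sum>k\<in>{2 * m<..n}. c k)"
      by (intro sum.union_disjoint) auto
    also have "\<dots> \<le> 2 * sqrt 2 * A * total / sqrt (real m * h) + 10 * A * total / sqrt (real (2 * m) * h)"
      using True less.prems by (intro add_mono dyadic_block_le less.hyps) auto
    also have "\<dots> = (2 * sqrt 2 + 10 / sqrt 2) * B"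
      by (simp add: B_def real_sqrt_mult algebra_simps)
    also have "\<dots> \<le> 10 * B" using num B by (intro mult_right_mono) auto
    finally show ?thesis by (simp add: B_def)
  next
    case False
    then show ?thesis using B by (simp add: B_def)
  qed
qed

lemma head_ge:
  assumes "1 \<le> m"
  shows "total - (\<Sum>k\<le>m. c k) \<le> 10 * A * total / sqrt (real m * h)"
proof -
  have "(\<lambda>n. \<Sum>k\<le>n. c k) \<longlonglongrightarrow> total"
    using c_sums by (simp add: sums_def_le)
  then have "(\<lambda>n. (\<Sum>k\<le>n. c k) - (\<Sum>k\<le>m. c k)) \<longlonglongrightarrow> total - (\<Sum>k\<le>m. c k)"
    by (intro tendsto_intros)
  moreover have "eventually (\<lambda>n. (\<Sum>k\<le>n. c k) - (\<Sum>k\<le>m. c k) \<le> 10 * A * total / sqrt (real m * h)) sequentially"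
    using eventually_ge_at_top[of m]
  proof eventually_elim
    case (elim n)
    have "(\<Sum>k\<le>n. c k) - (\<Sum>k\<le>m. c k) = (\<Sum>k\<in>{..n} - {..m}. c k)"
      using elim by (subst sum_diff) auto
    also have "{..n} - {..m} = {m<..n}" by auto
    finally show ?case using tail_le[OF assms, of n] by simp
  qed
  ultimately show ?thesis by (rule tendsto_upperbound) simp
qed

text \<open>This is the local bound \<open>c k = O(k^(-3/2))\<close>. In the recursion, indices up
  to \<open>k / 2\<close> carry at most the mass \<open>total\<close> and meet small weights; the
  others meet weights up to \<open>A\<close> but carry only the small mass allowed by
  \<open>tail_le\<close>.\<close>

lemma c_le:
  assumes "2 \<le> k"
  shows "real k * c k \<le> 20 * A\<^sup>2 * total / sqrt (real k * h)"
proof -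
  define m where "m = k div 2"
  have m: "1 \<le> m" "2 * m \<le> k" "k \<le> 3 * m" using assms by (auto simp: m_def)
  define B where "B = total / sqrt (real k * h)"
  have B: "0 \<le> B" using total_pos h by (simp add: B_def)
  have "real k * c k = (\<Sum>i<k. c i * r (k - i))" by (rule exp_coeff_rec)
  also have "\<dots> = (\<Sum>i\<le>m. c i * r (k - i)) + (\<Sum>i\<in>{m<..<k}. c i * r (k - i))"
    using m by (subst sum.union_disjoint[symmetric]) (auto intro!: sum.cong)
  also have "(\<Sum>i\<le>m. c i * r (k - i)) \<le> (\<Sum>i\<le>m. c i * (sqrt 2 * A / sqrt (real k * h)))"
  proof (intro sum_mono mult_left_mono c_nonneg)
    fix i assume i: "i \<in> {..m}"
    have ki: "1 \<le> k - i" "real k / 2 \<le> real (k - i)" using m i by auto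
    have "r (k - i) \<le> A / sqrt (real (k - i) * h)" using ki by (intro r_le_sqrt)
    also have "\<dots> \<le> A / sqrt (real k / 2 * h)"
      using ki h A m by (intro divide_left_mono real_sqrt_le_mono mult_right_mono mult_pos_pos) auto
    also have "\<dots> = sqrt 2 * A / sqrt (real k * h)"
      by (simp add: real_sqrt_mult real_sqrt_divide)
    finally show "r (k - i) \<le> sqrt 2 * A / sqrt (real k * h)" .
  qed
  also have "\<dots> = sum c {..m} * (sqrt 2 * A / sqrt (real k * h))" by (rule sum_distrib_right[symmetric])
  also have "\<dots> \<le> total * (sqrt 2 * A / sqrt (real k * h))"
    using A h by (intro mult_right_mono sum_c_le) auto
  also have "(\<Sum>i\<in>{m<..<k}. c i * r (k - i)) \<le> (\<Sum>i\<in>{m<..k}. c i) * A"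
    unfolding sum_distrib_right
    using c_nonneg r_nonneg r_le A by (intro order_trans[OF sum_mono sum_mono2] mult_left_mono) auto
  also have "\<dots> \<le> (10 * A * total / sqrt (real m * h)) * A"
    using A by (intro mult_right_mono tail_le m) auto
  also have "\<dots> \<le> (10 * A * total / sqrt (real k / 3 * h)) * A"
    using m h A total_pos
    by (intro mult_right_mono divide_left_mono real_sqrt_le_mono mult_pos_pos) auto
  also have "total * (sqrt 2 * A / sqrt (real k * h)) + (10 * A * total / sqrt (real k / 3 * h)) * A
      = (sqrt 2 * A + 10 * sqrt 3 * A\<^sup>2) * B"
    by (simp add: B_def real_sqrt_mult real_sqrt_divide power2_eq_square algebra_simps)
  also have "\<dots> \<le> (20 * A\<^sup>2) * B"
  proof (rule mult_right_mono[OF _ B])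
    have s: "sqrt 2 \<le> (3/2 :: real)" "sqrt 3 \<le> (7/4 :: real)"
      by (rule real_le_lsqrt; simp add: power2_eq_square)+
    have "sqrt 2 * A + 10 * sqrt 3 * A\<^sup>2 \<le> 3/2 * A\<^sup>2 + 10 * (7/4) * A\<^sup>2"
      using s A by (intro add_mono mult_mono) (auto simp: power2_eq_square)
    also have "\<dots> \<le> 20 * A\<^sup>2" by (simp add: algebra_simps)
    finally show "sqrt 2 * A + 10 * sqrt 3 * A\<^sup>2 \<le> 20 * A\<^sup>2" .
  qed
  finally show ?thesis by (simp add: B_def)
qed

text \<open>Three ranges of \<open>k\<close> in the recursion. Up to \<open>m\<close> the weight is
  close to \<open>\<sigma> / sqrt (n * h)\<close> and the mass is nearly \<open>total\<close>; up to
  \<open>n / 2\<close> the weights keep that order but the mass is a tail of \<open>c\<close>;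
  beyond \<open>n / 2\<close> the weights may be of order \<open>1\<close>, and \<open>c_le\<close>
  compensates.\<close>

lemma renewal_estimate:
  assumes m: "1 \<le> m" "2 * m \<le> n" and \<sigma>: "0 \<le> \<sigma>"
    and near: "\<And>k. k \<le> m \<Longrightarrow> \<bar>r (n - k) * sqrt (real n * h) - \<sigma>\<bar> \<le> \<delta>"
  shows "\<bar>real n * c n * sqrt (real n * h) / total - \<sigma>\<bar>
    \<le> \<delta> + (10 * A * \<sigma> + 200 * A ^ 3) / sqrt (real m * h)"
proof -
  define s where "s = sqrt (real n * h)"
  define t where "t = sqrt (real m * h)"
  have st: "0 < s" "0 < t" "t \<le> s" using m h by (auto simp: s_def t_def)
  have s2: "sqrt 2 \<le> (3/2 :: real)" by (rule real_le_lsqrt) (simp_all add: power2_eq_square)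
  define d where "d = n div 2"
  have d: "m \<le> d" "2 * d \<le> n" "n < 2 * (d + 1)" using m by (auto simp: d_def)
  define R1 where "R1 = (\<Sum>k\<in>{m<..d}. c k * r (n - k))"
  define R2 where "R2 = (\<Sum>k\<in>{d<..<n}. c k * r (n - k))"
  have "real n * c n = (\<Sum>k<n. c k * r (n - k))" by (rule exp_coeff_rec)
  also have "{..<n} = {..m} \<union> {m<..d} \<union> {d<..<n}" using m d by auto
  also have "(\<Sum>k\<in>\<dots>. c k * r (n - k)) = (\<Sum>k\<le>m. c k * r (n - k)) + R1 + R2"
    using d unfolding R1_def R2_def by (subst sum.union_disjoint, auto)+
  finally have dec: "real n * c n = (\<Sum>k\<le>m. c k * r (n - k)) + R1 + R2" .
  have R0: "0 \<le> R1" "0 \<le> R2"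
    unfolding R1_def R2_def using c_nonneg r_nonneg by (auto intro!: sum_nonneg mult_nonneg_nonneg)
  have R1: "R1 * s \<le> 15 * A\<^sup>2 * total / t"
  proof -
    have "R1 \<le> (\<Sum>k\<in>{m<..d}. c k * (sqrt 2 * A / s))"
      unfolding R1_def
    proof (intro sum_mono mult_left_mono c_nonneg)
      fix k assume k: "k \<in> {m<..d}"
      have nk: "1 \<le> n - k" "real n / 2 \<le> real (n - k)" using d k m by auto
      have "r (n - k) \<le> A / sqrt (real (n - k) * h)" using nk by (intro r_le_sqrt)
      also have "\<dots> \<le> A / sqrt (real n / 2 * h)"
        using nk h A m by (intro divide_left_mono real_sqrt_le_mono mult_right_mono mult_pos_pos) auto
      also have "\<dots> = sqrt 2 * A / s"
        by (simp add: s_def real_sqrt_mult real_sqrt_divide)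
      finally show "r (n - k) \<le> sqrt 2 * A / s" .
    qed
    also have "\<dots> = (\<Sum>k\<in>{m<..d}. c k) * (sqrt 2 * A / s)" by (rule sum_distrib_right[symmetric])
    also have "\<dots> \<le> (10 * A * total / t) * (3/2 * A / s)"
      unfolding t_def
      using A st s2 h total_pos m by (intro mult_mono tail_le divide_right_mono mult_right_mono) auto
    finally show ?thesis using st by (simp add: field_simps power2_eq_square)
  qed
  \<comment> \<open>\<open>c_le\<close> contributes the factor \<open>1 / (n * s)\<close> and the
    sum of the weights \<open>sqrt n / sqrt h\<close>; after scaling by \<open>s\<close> this leaves
    \<open>1 / s\<close>, which is at most \<open>1 / t\<close>.\<close>
  have R2: "R2 * s \<le> 120 * A ^ 3 * total / t"
  proof -
    have "R2 \<le> (\<Sum>k\<in>{d<..<n}. (60 * A\<^sup>2 * total / (real n * s)) * r (n - k))"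
      unfolding R2_def
    proof (intro sum_mono mult_right_mono r_nonneg)
      fix k assume k: "k \<in> {d<..<n}"
      then have k2: "2 \<le> k" "real n / 2 \<le> real k" using d m by auto
      have "c k \<le> 20 * A\<^sup>2 * total / sqrt (real k * h) / real k"
        using c_le[of k] k2 by (subst pos_le_divide_eq) (auto simp: mult.commute)
      also have "\<dots> \<le> 20 * A\<^sup>2 * total / sqrt (real n / 2 * h) / (real n / 2)"
        using k2 m h A total_pos
        by (intro frac_le divide_left_mono real_sqrt_le_mono mult_right_mono mult_pos_pos divide_nonneg_nonneg) auto
      also have "\<dots> = 40 * sqrt 2 * A\<^sup>2 * total / (real n * s)"
        by (simp add: s_def real_sqrt_mult real_sqrt_divide mult_ac)
      also have "\<dots> \<le> 60 * A\<^sup>2 * total / (real n * s)"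
        using s2 m st total_pos by (intro divide_right_mono mult_right_mono) auto
      finally show "c k \<le> 60 * A\<^sup>2 * total / (real n * s)" .
    qed
    also have "\<dots> = (60 * A\<^sup>2 * total / (real n * s)) * (\<Sum>k\<in>{d<..<n}. r (n - k))"
      by (rule sum_distrib_left[symmetric])
    also have "(\<Sum>k\<in>{d<..<n}. r (n - k)) = (\<Sum>j\<in>{0<..<n - d}. r j)"
      using d by (intro sum.reindex_bij_witness[of _ "\<lambda>j. n - j" "\<lambda>k. n - k"]) auto
    also have "(60 * A\<^sup>2 * total / (real n * s)) * \<dots> \<le> (60 * A\<^sup>2 * total / (real n * s)) * (2 * A * sqrt (real n) / sqrt h)"
    proof (rule mult_left_mono)
      show "(\<Sum>j\<in>{0<..<n - d}. r j) \<le> 2 * A * sqrt (real n) / sqrt h"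
        using r_nonneg by (intro order_trans[OF sum_mono2 sum_r_le]) auto
    qed (use total_pos st in auto)
    also have "\<dots> = 120 * A ^ 3 * total * (sqrt (real n) / (real n * s * sqrt h))"
      by (simp add: power2_eq_square power3_eq_cube)
    also have "sqrt (real n) / (real n * s * sqrt h) = 1 / (s * s)"
    proof -
      have "sqrt (real n) * sqrt (real n) = real n" by simp
      then show ?thesis using h m by (simp add: s_def real_sqrt_mult field_simps)
    qed
    finally have "R2 * s \<le> 120 * A ^ 3 * total * (1 / (s * s)) * s"
      using st by (intro mult_right_mono) auto
    also have "\<dots> = 120 * A ^ 3 * total / s" using st by simp
    also have "\<dots> \<le> 120 * A ^ 3 * total / t"
      using st A total_pos by (intro divide_left_mono) auto
    finally show ?thesis .
  qed
  have A23: "A\<^sup>2 \<le> A ^ 3" using A by (intro power_increasing) auto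
  have head: "\<bar>(\<Sum>k\<le>m. c k * r (n - k)) * s - \<sigma> * (\<Sum>k\<le>m. c k)\<bar> \<le> \<delta> * total"
  proof -
    have "(\<Sum>k\<le>m. c k * r (n - k)) * s - \<sigma> * (\<Sum>k\<le>m. c k) = (\<Sum>k\<le>m. c k * (r (n - k) * s - \<sigma>))"
      by (simp add: sum_distrib_left sum_distrib_right sum_subtractf algebra_simps)
    also have "\<bar>\<dots>\<bar> \<le> (\<Sum>k\<le>m. c k * \<delta>)"
      using near c_nonneg unfolding s_def
      by (intro order_trans[OF sum_abs sum_mono]) (auto simp: abs_mult intro!: mult_left_mono)
    also have "\<dots> = \<delta> * sum c {..m}" by (simp add: mult.commute flip: sum_distrib_left sum_distrib_right)
    also have "\<dots> \<le> \<delta> * total"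
      using near[of 0] by (intro mult_left_mono sum_c_le) auto
    finally show ?thesis .
  qed
  have head': "\<bar>\<sigma> * (\<Sum>k\<le>m. c k) - \<sigma> * total\<bar> \<le> \<sigma> * (10 * A * total / t)"
  proof -
    have "\<bar>\<sigma> * (\<Sum>k\<le>m. c k) - \<sigma> * total\<bar> = \<sigma> * (total - (\<Sum>k\<le>m. c k))"
      using \<sigma> sum_c_le[of "{..m}"] by (simp add: abs_mult flip: right_diff_distrib)
    also have "\<dots> \<le> \<sigma> * (10 * A * total / t)"
      unfolding t_def using \<sigma> m by (intro mult_left_mono head_ge) auto
    finally show ?thesis .
  qed
  have "real n * c n * s - \<sigma> * total = ((\<Sum>k\<le>m. c k * r (n - k)) * s - \<sigma> * (\<Sum>k\<le>m. c k))
      + (\<sigma> * (\<Sum>k\<le>m. c k) - \<sigma> * total) + (R1 * s + R2 * s)"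
    unfolding dec by (simp add: algebra_simps)
  moreover have "0 \<le> R1 * s + R2 * s" using R0 st by simp
  ultimately have "\<bar>real n * c n * s - \<sigma> * total\<bar> \<le> \<delta> * total + \<sigma> * (10 * A * total / t) + (R1 * s + R2 * s)"
    using head head' by linarith
  also have "R1 * s + R2 * s \<le> 15 * A ^ 3 * total / t + 120 * A ^ 3 * total / t"
  proof (rule add_mono[OF order_trans[OF R1] R2])
    show "15 * A\<^sup>2 * total / t \<le> 15 * A ^ 3 * total / t"
      using A23 st total_pos by (intro divide_right_mono mult_right_mono mult_left_mono) auto
  qed
  also have "\<dots> \<le> 200 * A ^ 3 * total / t"
    using A st total_pos by (simp add: divide_simps)
  also have "\<delta> * total + \<sigma> * (10 * A * total / t) + 200 * A ^ 3 * total / t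
      = (\<delta> + (10 * A * \<sigma> + 200 * A ^ 3) / t) * total"
    using st by (simp add: field_simps)
  finally have "\<bar>real n * c n * s - \<sigma> * total\<bar> / total \<le> \<delta> + (10 * A * \<sigma> + 200 * A ^ 3) / t"
    using total_pos by (simp add: divide_le_eq)
  moreover have "\<bar>real n * c n * s - \<sigma> * total\<bar> / total = \<bar>real n * c n * s / total - \<sigma>\<bar>"
  proof -
    have "real n * c n * s / total - \<sigma> = (real n * c n * s - \<sigma> * total) / total"
      using total_pos by (simp add: field_simps)
    then show ?thesis using total_pos by (simp add: abs_divide)
  qed
  ultimately show ?thesis by (simp add: s_def t_def)
qed

end

subsection \<open>The normal tail\<close>

lemma std_normal_tail_eq_measure:
  "std_normal_tail x = measure std_normal_distribution {x..}"
proof -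
  have "integrable lborel (\<lambda>u. indicator {x..} u * std_normal_density u)"
    using integrable_mult_indicator[of "{x..}" lborel std_normal_density] by simp
  then have "emeasure std_normal_distribution {x..} = ennreal (std_normal_tail x)"
    unfolding std_normal_tail_def set_lebesgue_integral_def
    by (subst emeasure_density)
      (auto simp: nn_integral_eq_integral[symmetric] ennreal_mult' mult.commute ennreal_indicator
        intro!: nn_integral_cong split: split_indicator)
  moreover have "0 \<le> std_normal_tail x"
    unfolding std_normal_tail_def set_lebesgue_integral_def by (intro integral_nonneg_AE) auto
  ultimately show ?thesis by (simp add: measure_def)
qed

lemma std_normal_singleton: "measure std_normal_distribution {x} = 0"
proof -
  have "emeasure std_normal_distribution {x} = (\<integral>\<^sup>+u. ennreal (std_normal_density u) * indicator {x} u \<partial>lborel)"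
    by (subst emeasure_density) auto
  also have "\<dots> = (\<integral>\<^sup>+(u::real). 0 \<partial>lborel)"
    by (rule nn_integral_cong_AE) (use AE_lborel_singleton[of x] in \<open>auto elim: eventually_mono\<close>)
  finally show ?thesis by (simp add: measure_def)
qed

lemma std_normal_tail_eq_cdf: "std_normal_tail x = 1 - cdf std_normal_distribution x"
proof -
  interpret real_distribution std_normal_distribution by (rule real_dist_normal_dist)
  have "{x..} = {x} \<union> {x<..}" by auto
  then have "measure std_normal_distribution {x..} = measure std_normal_distribution {x<..}"
    using finite_measure_Union[of "{x}" "{x<..}"] std_normal_singleton[of x] by auto
  also have "{x<..} = space std_normal_distribution - {..x}" by auto
  also have "measure std_normal_distribution \<dots> = 1 - cdf std_normal_distribution x"
    unfolding cdf_def by (rule prob_compl) auto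
  finally show ?thesis unfolding std_normal_tail_eq_measure .
qed

lemma isCont_cdf_std_normal: "isCont (cdf std_normal_distribution) x"
proof -
  interpret real_distribution std_normal_distribution by (rule real_dist_normal_dist)
  show ?thesis using isCont_cdf std_normal_singleton by simp
qed

lemma isCont_std_normal_tail: "isCont std_normal_tail x"
  unfolding std_normal_tail_eq_cdf[abs_def] by (intro continuous_intros isCont_cdf_std_normal)

lemma std_normal_tail_measurable [measurable]: "std_normal_tail \<in> borel_measurable borel"
  by (intro borel_measurable_continuous_onI continuous_at_imp_continuous_on ballI isCont_std_normal_tail)

lemma std_normal_tail_nonneg: "0 \<le> std_normal_tail x"
  unfolding std_normal_tail_eq_measure by simp

lemma ennreal_std_normal_tail:
  "ennreal (std_normal_tail x) = (\<integral>\<^sup>+u. ennreal (std_normal_density u) * indicator {x..} u \<partial>lborel)"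
proof -
  interpret real_distribution std_normal_distribution by (rule real_dist_normal_dist)
  show ?thesis
    unfolding std_normal_tail_eq_measure emeasure_eq_measure[symmetric]
    by (subst emeasure_density) auto
qed

text \<open>Both bounds compare the tail with the integral of \<open>std_normal_density u * (1 + 1 / u\<^sup>2)\<close>, whose
  antiderivative is \<open>- std_normal_density u / u\<close>.\<close>

lemma std_normal_tail_bounds:
  assumes x: "0 < x"
  shows "std_normal_tail x \<le> std_normal_density x / x"
    and "std_normal_density x / x \<le> (1 + 1 / x\<^sup>2) * std_normal_tail x"
proof -
  obtain K where K: "std_normal_density u = K * exp (- u\<^sup>2 / 2)" for u
    unfolding std_normal_density_def by blast
  let ?I = "\<integral>\<^sup>+u. ennreal (std_normal_density u * (1 + 1 / u\<^sup>2)) * indicator {x..} u \<partial>lborel"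
  have I: "?I = 0 - (- (std_normal_density x / x))"
  proof (rule nn_integral_FTC_atLeast)
    fix u :: real assume "x \<le> u"
    then have "u \<noteq> 0" using x by auto
    then show "((\<lambda>u. - (std_normal_density u / u)) has_real_derivative std_normal_density u * (1 + 1 / u\<^sup>2)) (at u)"
      unfolding K
      by (auto intro!: derivative_eq_intros simp: field_simps power2_eq_square)
  next
    show "((\<lambda>u. - (std_normal_density u / u)) \<longlongrightarrow> 0) at_top"
      unfolding K by real_asymp
  qed auto
  have "ennreal (std_normal_tail x) \<le> ?I"
    unfolding ennreal_std_normal_tail
    by (intro nn_integral_mono mult_right_mono ennreal_leI) (auto simp: algebra_simps)
  then show "std_normal_tail x \<le> std_normal_density x / x"
    unfolding I using x by (subst (asm) ennreal_le_iff) auto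
  have "?I \<le> (\<integral>\<^sup>+u. ennreal (1 + 1 / x\<^sup>2) * (ennreal (std_normal_density u) * indicator {x..} u) \<partial>lborel)"
  proof (rule nn_integral_mono)
    fix u
    have "std_normal_density u * (1 + 1 / u\<^sup>2) \<le> (1 + 1 / x\<^sup>2) * std_normal_density u" if "x \<le> u"
    proof -
      have "1 + 1 / u\<^sup>2 \<le> 1 + 1 / x\<^sup>2"
        using that x by (intro add_left_mono divide_left_mono power_mono mult_pos_pos) auto
      then show ?thesis by (subst mult.commute) (intro mult_right_mono, auto)
    qed
    then show "ennreal (std_normal_density u * (1 + 1 / u\<^sup>2)) * indicator {x..} u
        \<le> ennreal (1 + 1 / x\<^sup>2) * (ennreal (std_normal_density u) * indicator {x..} u)"
      by (auto split: split_indicator simp: ennreal_mult[symmetric] simp del: ennreal_plus intro!: ennreal_leI)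
  qed
  also have "\<dots> = ennreal (1 + 1 / x\<^sup>2) * ennreal (std_normal_tail x)"
    unfolding ennreal_std_normal_tail by (subst nn_integral_cmult) auto
  also have "\<dots> = ennreal ((1 + 1 / x\<^sup>2) * std_normal_tail x)"
    by (subst ennreal_mult) (auto simp: std_normal_tail_nonneg)
  finally show "std_normal_density x / x \<le> (1 + 1 / x\<^sup>2) * std_normal_tail x"
    unfolding I by (subst (asm) ennreal_le_iff) (auto simp: std_normal_tail_nonneg)
qed

lemma std_normal_tail_pos: "0 < std_normal_tail x"
proof -
  define y where "y = max x 1"
  have y: "0 < y" "x \<le> y" by (auto simp: y_def)
  interpret real_distribution std_normal_distribution by (rule real_dist_normal_dist)
  have "0 < std_normal_density y / y" using y by (intro divide_pos_pos) (simp_all add: std_normal_density_def)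
  also have "\<dots> \<le> (1 + 1 / y\<^sup>2) * std_normal_tail y" by (rule std_normal_tail_bounds(2)[OF y(1)])
  finally have "0 < std_normal_tail y" using y by (elim zero_less_mult_pos) (simp add: add_pos_pos)
  also have "\<dots> \<le> std_normal_tail x"
    unfolding std_normal_tail_eq_measure using y by (intro finite_measure_mono) auto
  finally show ?thesis .
qed

text \<open>The factor \<open>exp (t / 2)\<close> cancels the Gaussian decay of the density at
  \<open>sqrt t\<close>. With \<open>t = j * a^2\<close> this describes the size of the tilted
  weights.\<close>

lemma scaled_tail_bounds:
  assumes t: "0 < t"
  shows "std_normal_tail (sqrt t) * exp (t / 2) * sqrt t \<le> 1 / sqrt (2 * pi)"
    and "1 / sqrt (2 * pi) \<le> (1 + 1 / t) * (std_normal_tail (sqrt t) * exp (t / 2) * sqrt t)"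
proof -
  have d: "std_normal_density (sqrt t) = (1 / sqrt (2 * pi)) / exp (t / 2)"
    using t by (simp add: std_normal_density_def exp_minus field_simps)
  have s: "0 < sqrt t" using t by simp
  have "std_normal_tail (sqrt t) * (exp (t / 2) * sqrt t)
      \<le> std_normal_density (sqrt t) / sqrt t * (exp (t / 2) * sqrt t)"
    using s by (intro mult_right_mono std_normal_tail_bounds) auto
  also have "\<dots> = 1 / sqrt (2 * pi)" using s by (simp add: d)
  finally show "std_normal_tail (sqrt t) * exp (t / 2) * sqrt t \<le> 1 / sqrt (2 * pi)"
    by (simp add: mult.assoc)
  have "std_normal_density (sqrt t) / sqrt t * (exp (t / 2) * sqrt t)
      \<le> (1 + 1 / (sqrt t)\<^sup>2) * std_normal_tail (sqrt t) * (exp (t / 2) * sqrt t)"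
    using s by (intro mult_right_mono std_normal_tail_bounds) auto
  then show "1 / sqrt (2 * pi) \<le> (1 + 1 / t) * (std_normal_tail (sqrt t) * exp (t / 2) * sqrt t)"
    using s t by (simp add: d mult_ac)
qed

lemma scaled_tail_tendsto:
  "((\<lambda>t. std_normal_tail (sqrt t) * exp (t / 2) * sqrt t) \<longlongrightarrow> 1 / sqrt (2 * pi)) at_top"
proof (rule tendsto_sandwich)
  have "((\<lambda>t. K / (1 + 1 / t)) \<longlongrightarrow> K) at_top" for K :: real
    by real_asymp
  then show "((\<lambda>t. 1 / sqrt (2 * pi) / (1 + 1 / t)) \<longlongrightarrow> 1 / sqrt (2 * pi)) at_top" .
  show "\<forall>\<^sub>F t in at_top. 1 / sqrt (2 * pi) / (1 + 1 / t) \<le> std_normal_tail (sqrt t) * exp (t / 2) * sqrt t"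
    using eventually_gt_at_top[of 0]
  proof eventually_elim
    case (elim t)
    then have "0 < 1 + 1 / t" by (simp add: add_pos_pos)
    then show ?case
      using scaled_tail_bounds(2)[OF elim] by (simp only: pos_divide_le_eq mult.commute[of _ "1 + 1 / t"])
  qed
  show "\<forall>\<^sub>F t in at_top. std_normal_tail (sqrt t) * exp (t / 2) * sqrt t \<le> 1 / sqrt (2 * pi)"
    using eventually_gt_at_top[of 0] by eventually_elim (rule scaled_tail_bounds(1))
qed (rule tendsto_const)

section \<open>The integral with value \<open>ln 2\<close>\<close>

lemma half_gaussian:
  assumes "0 < w"
  shows "has_bochner_integral lborel (\<lambda>u. indicator {0..} u * std_normal_density (w * u)) (1 / (2 * w))"
proof -
  \<comment> \<open>\<open>gaussian_moment_0\<close> integrates \<open>exp (- x^2)\<close>; the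
    substitution \<open>x = d * u\<close> produces \<open>exp (- (w * u)^2 / 2)\<close>.\<close>
  define d where "d = w / sqrt 2"
  have d: "d \<noteq> 0" "\<bar>d\<bar> = w / sqrt 2" using assms by (auto simp: d_def)
  have "has_bochner_integral lborel
      (\<lambda>u. indicator {0..} (0 + d * u) *\<^sub>R exp (- (0 + d * u)\<^sup>2)) ((sqrt pi / 2) /\<^sub>R \<bar>d\<bar>)"
    using gaussian_moment_0 by (subst (asm) lborel_has_bochner_integral_real_affine_iff[OF d(1), where t=0])
  then have "has_bochner_integral lborel
      (\<lambda>u. (1 / sqrt (2 * pi)) * (indicator {0..} (0 + d * u) *\<^sub>R exp (- (0 + d * u)\<^sup>2)))
      ((1 / sqrt (2 * pi)) * ((sqrt pi / 2) /\<^sub>R \<bar>d\<bar>))"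
    by (intro has_bochner_integral_mult_right)
  moreover have "(1 / sqrt (2 * pi)) * ((sqrt pi / 2) /\<^sub>R \<bar>d\<bar>) = 1 / (2 * w)"
    using assms unfolding d(2) by (simp add: real_sqrt_mult field_simps)
  moreover have "(1 / sqrt (2 * pi)) * (indicator {0..} (0 + d * u) *\<^sub>R exp (- (0 + d * u)\<^sup>2))
      = indicator {0..} u * std_normal_density (w * u)" for u
    using assms by (auto simp: d_def std_normal_density_def power_mult_distrib power_divide
        zero_le_mult_iff zero_le_divide_iff split: split_indicator)
  ultimately show ?thesis by simp
qed

text \<open>Since \<open>(exp (t / 2) - 1) / t\<close> is the integral of \<open>w * exp (t * (1 - w\<^sup>2) / 2)\<close> over
  \<open>0 \<le> w \<le> 1\<close>, Tonelli's theorem reduces the claim to \<open>\<integral> 1 / (1 + w) dw = ln 2\<close>.\<close>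

lemma nn_integral_tail_ln_2:
  "(\<integral>\<^sup>+t. ennreal (std_normal_tail (sqrt t) * ((exp (t / 2) - 1) / t)) * indicator {0<..} t \<partial>lborel)
    = ennreal (ln 2)"
proof -
  \<comment> \<open>The normal tail is itself an integral over \<open>u >= sqrt t\<close>, which
    makes the quantity a triple integral. The order is reversed until \<open>t\<close> comes first,
    where an exponential over \<open>0 < t <= u^2\<close> is integrated explicitly.\<close>
  define G :: "real \<Rightarrow> real \<Rightarrow> real \<Rightarrow> ennreal" where
    "G t w u = ennreal (if 0 < t \<and> 0 < w \<and> w < 1 \<and> sqrt t \<le> u
       then std_normal_density u * (w * exp (t * (1 - w\<^sup>2) / 2)) else 0)" for t w u
  have G [measurable (raw)]: "(\<lambda>x. G (f x) (g x) (k x)) \<in> borel_measurable N"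
    if "f \<in> borel_measurable N" "g \<in> borel_measurable N" "k \<in> borel_measurable N"
    for f g k and N :: "'z measure"
    using that unfolding G_def by measurable
  have w01: "AE w in lborel. w \<noteq> 0 \<and> w \<noteq> (1::real)"
    using AE_lborel_singleton[of 0] AE_lborel_singleton[of 1] by eventually_elim auto
  have L: "ennreal (std_normal_tail (sqrt t) * ((exp (t / 2) - 1) / t)) * indicator {0<..} t
      = (\<integral>\<^sup>+w. \<integral>\<^sup>+u. G t w u \<partial>lborel \<partial>lborel)" for t
  proof (cases "0 < t")
    case True
    have "(\<integral>\<^sup>+w. \<integral>\<^sup>+u. G t w u \<partial>lborel \<partial>lborel)
      = (\<integral>\<^sup>+w. ennreal (std_normal_tail (sqrt t)) * (ennreal (w * exp (t * (1 - w\<^sup>2) / 2)) * indicator {0..1} w) \<partial>lborel)"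
    proof (rule nn_integral_cong_AE, use w01 in eventually_elim)
      fix w :: real assume w: "w \<noteq> 0 \<and> w \<noteq> 1"
      show "(\<integral>\<^sup>+u. G t w u \<partial>lborel)
        = ennreal (std_normal_tail (sqrt t)) * (ennreal (w * exp (t * (1 - w\<^sup>2) / 2)) * indicator {0..1} w)"
      proof (cases "0 < w \<and> w < 1")
        case True
        then have "(\<integral>\<^sup>+u. G t w u \<partial>lborel)
          = (\<integral>\<^sup>+u. (ennreal (std_normal_density u) * indicator {sqrt t..} u) * ennreal (w * exp (t * (1 - w\<^sup>2) / 2)) \<partial>lborel)"
          unfolding G_def using \<open>0 < t\<close>
          by (intro nn_integral_cong) (auto simp: ennreal_mult' split: split_indicator)
        also have "\<dots> = ennreal (std_normal_tail (sqrt t)) * ennreal (w * exp (t * (1 - w\<^sup>2) / 2))"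
          unfolding ennreal_std_normal_tail by (rule nn_integral_multc) auto
        finally show ?thesis using True by simp
      qed (use w in \<open>auto simp: G_def split: split_indicator\<close>)
    qed
    also have "\<dots> = ennreal (std_normal_tail (sqrt t))
        * (\<integral>\<^sup>+w. ennreal (w * exp (t * (1 - w\<^sup>2) / 2)) * indicator {0..1} w \<partial>lborel)"
      by (rule nn_integral_cmult) auto
    also have "(\<integral>\<^sup>+w. ennreal (w * exp (t * (1 - w\<^sup>2) / 2)) * indicator {0..1} w \<partial>lborel)
        = ennreal (- (exp (t * (1 - 1\<^sup>2) / 2) / t) - (- (exp (t * (1 - 0\<^sup>2) / 2) / t)))"
    proof (rule nn_integral_FTC_Icc[where F="\<lambda>w. - (exp (t * (1 - w\<^sup>2) / 2) / t)"])
      fix w :: real assume "w \<in> {0..1}"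
      show "((\<lambda>w. - (exp (t * (1 - w\<^sup>2) / 2) / t)) has_real_derivative w * exp (t * (1 - w\<^sup>2) / 2)) (at w)"
        using True by (auto intro!: derivative_eq_intros)
    qed auto
    also have "- (exp (t * (1 - 1\<^sup>2) / 2) / t) - (- (exp (t * (1 - 0\<^sup>2) / 2) / t)) = (exp (t / 2) - 1) / t"
      using True by (simp add: field_simps)
    also have "ennreal (std_normal_tail (sqrt t)) * ennreal ((exp (t / 2) - 1) / t)
        = ennreal (std_normal_tail (sqrt t) * ((exp (t / 2) - 1) / t))"
      by (rule ennreal_mult'[symmetric]) (rule std_normal_tail_nonneg)
    finally show ?thesis using True by simp
  qed (simp add: G_def)
  \<comment> \<open>With \<open>b = (1 - w^2) / 2\<close> the factor \<open>exp (u^2 * b)\<close>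
    turns the normal density at \<open>u\<close> into that at \<open>w * u\<close>. Integrating out
    \<open>t\<close> thus leaves a difference of two Gaussians, both known from
    \<open>half_gaussian\<close>.\<close>
  have inner: "(\<integral>\<^sup>+u. \<integral>\<^sup>+t. G t w u \<partial>lborel \<partial>lborel) = ennreal (1 / (1 + w))" if w: "0 < w" "w < 1" for w
  proof -
    define b where "b = (1 - w\<^sup>2) / 2"
    have b: "0 < b" using w by (simp add: b_def power_less_one_iff)
    have "(\<integral>\<^sup>+t. G t w u \<partial>lborel)
        = ennreal (w / b * (indicator {0..} u * std_normal_density (w * u) - indicator {0..} u * std_normal_density (1 * u)))"
      for u
    proof (cases "0 < u")
      case True
      have "(\<integral>\<^sup>+t. G t w u \<partial>lborel)
          = (\<integral>\<^sup>+t. ennreal (std_normal_density u * w * exp (t * b)) * indicator {0..u\<^sup>2} t \<partial>lborel)"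
      proof (rule nn_integral_cong_AE, use AE_lborel_singleton[of 0] in eventually_elim)
        fix t :: real assume "t \<noteq> 0"
        moreover have "sqrt t \<le> u \<longleftrightarrow> t \<le> u\<^sup>2"
          using True by (auto intro: real_le_lsqrt dest: sqrt_le_D)
        ultimately show "G t w u = ennreal (std_normal_density u * w * exp (t * b)) * indicator {0..u\<^sup>2} t"
          using w by (auto simp: G_def b_def mult.assoc split: split_indicator)
      qed
      also have "\<dots> = ennreal (std_normal_density u * w * exp (u\<^sup>2 * b) / b - std_normal_density u * w * exp (0 * b) / b)"
      proof (rule nn_integral_FTC_Icc[where F="\<lambda>t. std_normal_density u * w * exp (t * b) / b"])
        fix t :: real
        show "((\<lambda>t. std_normal_density u * w * exp (t * b) / b) has_real_derivative std_normal_density u * w * exp (t * b)) (at t)"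
          using b by (auto intro!: derivative_eq_intros)
        show "0 \<le> std_normal_density u * w * exp (t * b)" using w by auto
      qed auto
      also have "std_normal_density u * w * exp (u\<^sup>2 * b) / b - std_normal_density u * w * exp (0 * b) / b
        = w / b * (indicator {0..} u * std_normal_density (w * u) - indicator {0..} u * std_normal_density (1 * u))"
      proof -
        have "std_normal_density u * exp (u\<^sup>2 * b) = std_normal_density (w * u)"
          unfolding std_normal_density_def b_def
          by (simp add: exp_add[symmetric] field_simps power_mult_distrib)
        then have "w * (std_normal_density u * exp (u\<^sup>2 * b)) = w * std_normal_density (w * u)"
          by simp
        then show ?thesis using True b by (simp add: field_simps)
      qed
      finally show ?thesis .
    next
      case False
      have "G t w u = 0" for t
      proof (cases "0 < t")
        case True
        then have "0 < sqrt t" by simp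
        then have "\<not> sqrt t \<le> u" using False by linarith
        then show ?thesis by (simp add: G_def)
      qed (simp add: G_def)
      then show ?thesis using False by (cases "u = 0") (auto split: split_indicator)
    qed
    moreover have "(\<integral>\<^sup>+u. ennreal (w / b * (indicator {0..} u * std_normal_density (w * u)
        - indicator {0..} u * std_normal_density (1 * u))) \<partial>lborel) = ennreal (w / b * (1 / (2 * w) - 1 / (2 * 1)))"
    proof -
      let ?f = "\<lambda>u. w / b * (indicator {0..} u * std_normal_density (w * u)
        - indicator {0..} u * std_normal_density (1 * u))"
      have f: "has_bochner_integral lborel ?f (w / b * (1 / (2 * w) - 1 / (2 * 1)))"
        using w by (intro has_bochner_integral_mult_right has_bochner_integral_diff half_gaussian) auto
      have "0 \<le> ?f u" for u
      proof -
        have "(w * u)\<^sup>2 \<le> u\<^sup>2" using w by (simp add: power_mult_distrib mult_left_le_one_le power_le_one)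
        then show ?thesis
          using w b by (auto simp: std_normal_density_def divide_right_mono split: split_indicator intro!: mult_nonneg_nonneg)
      qed
      moreover have "integrable lborel ?f" "integral\<^sup>L lborel ?f = w / b * (1 / (2 * w) - 1 / (2 * 1))"
        using f unfolding has_bochner_integral_iff by blast+
      ultimately show ?thesis
        using nn_integral_eq_integral[of lborel ?f] by (simp only: AE_I2)
    qed
    moreover have "w / b * (1 / (2 * w) - 1 / (2 * 1)) = 1 / (1 + w)"
    proof -
      have "1 - w\<^sup>2 = (1 - w) * (1 + w)" by (simp add: power2_eq_square algebra_simps)
      then show ?thesis using w by (simp add: b_def divide_simps)
    qed
    ultimately show ?thesis by simp
  qed
  have "(\<integral>\<^sup>+t. ennreal (std_normal_tail (sqrt t) * ((exp (t / 2) - 1) / t)) * indicator {0<..} t \<partial>lborel)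
      = (\<integral>\<^sup>+t. \<integral>\<^sup>+w. \<integral>\<^sup>+u. G t w u \<partial>lborel \<partial>lborel \<partial>lborel)"
    unfolding L ..
  also have "\<dots> = (\<integral>\<^sup>+w. \<integral>\<^sup>+t. \<integral>\<^sup>+u. G t w u \<partial>lborel \<partial>lborel \<partial>lborel)"
    by (rule lborel_pair.Fubini') measurable
  also have "\<dots> = (\<integral>\<^sup>+w. \<integral>\<^sup>+u. \<integral>\<^sup>+t. G t w u \<partial>lborel \<partial>lborel \<partial>lborel)"
    by (intro nn_integral_cong lborel_pair.Fubini') measurable
  also have "\<dots> = (\<integral>\<^sup>+w. ennreal (1 / (1 + w)) * indicator {0..1} w \<partial>lborel)"
  proof (rule nn_integral_cong_AE, use w01 in eventually_elim)
    fix w :: real assume w: "w \<noteq> 0 \<and> w \<noteq> 1"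
    show "(\<integral>\<^sup>+u. \<integral>\<^sup>+t. G t w u \<partial>lborel \<partial>lborel) = ennreal (1 / (1 + w)) * indicator {0..1} w"
    proof (cases "0 < w \<and> w < 1")
      case False
      then have "G t w u = 0" for t u by (auto simp: G_def)
      then show ?thesis using False w by (auto split: split_indicator)
    qed (simp add: inner)
  qed
  also have "\<dots> = ennreal (ln (1 + 1) - ln (1 + 0))"
  proof (rule nn_integral_FTC_Icc[where F="\<lambda>w. ln (1 + w)"])
    fix w :: real assume "w \<in> {0..1}"
    then show "((\<lambda>w. ln (1 + w)) has_real_derivative 1 / (1 + w)) (at w)"
      by (auto intro!: derivative_eq_intros)
  qed auto
  finally show ?thesis by simp
qed

subsection \<open>Centred walks with unit variance\<close>

lemma enat_less_INF_iff: "enat k < (INF i\<in>A. enat i) \<longleftrightarrow> (\<forall>i\<in>A. k < i)"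
  unfolding Suc_ile_eq[symmetric] le_INF_iff by (auto simp: Suc_le_eq)

text \<open>The sets \<open>k < f\<close> are the path events at hand for an exit time; finite level
  sets are differences of them, and the value \<open>\<infinity>\<close> is their
  intersection.\<close>

lemma measurable_enatI:
  fixes f :: "'a \<Rightarrow> enat"
  assumes "\<And>k. {\<omega> \<in> space M. enat k < f \<omega>} \<in> sets M"
  shows "f \<in> measurable M (count_space UNIV)"
proof (subst measurable_count_space_eq_countable, safe)
  fix y :: enat
  show "f -` {y} \<inter> space M \<in> sets M"
  proof (cases y)
    case (enat k)
    have "f -` {y} \<inter> space M = (if k = 0 then space M else {\<omega> \<in> space M. enat (k - 1) < f \<omega>})
        - {\<omega> \<in> space M. enat k < f \<omega>}"
    proof (rule set_eqI)
      fix \<omega>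
      show "\<omega> \<in> f -` {y} \<inter> space M \<longleftrightarrow> \<omega> \<in> (if k = 0 then space M else {\<omega> \<in> space M. enat (k - 1) < f \<omega>})
          - {\<omega> \<in> space M. enat k < f \<omega>}"
        by (cases "f \<omega>") (auto simp: enat)
    qed
    then show ?thesis using assms by auto
  next
    case infinity
    have "f -` {y} \<inter> space M = (\<Inter>k. {\<omega> \<in> space M. enat k < f \<omega>})"
    proof (rule set_eqI)
      fix \<omega>
      show "\<omega> \<in> f -` {y} \<inter> space M \<longleftrightarrow> \<omega> \<in> (\<Inter>k. {\<omega> \<in> space M. enat k < f \<omega>})"
        by (cases "f \<omega>") (auto simp: infinity)
    qed
    then show ?thesis using assms by auto
  qed
qed auto

locale iid_standard = prob_space M for M :: "'a measure" +
  fixes X :: "nat \<Rightarrow> 'a \<Rightarrow> real"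
  assumes indep_X: "indep_vars (\<lambda>_. borel) X UNIV"
    and ident_X: "\<And>i. distr M borel (X i) = distr M borel (X 0)"
    and integrable_X0: "integrable M (X 0)" and mean_X0: "(LINT \<omega>|M. X 0 \<omega>) = 0"
    and square_integrable_X0: "integrable M (\<lambda>\<omega>. X 0 \<omega> ^ 2)" and second_moment_X0: "(LINT \<omega>|M. X 0 \<omega> ^ 2) = 1"
begin

lemma X_measurable [measurable]: "random_variable borel (X i)"
  using indep_X by (auto simp: indep_vars_def)

lemma X_transfer:
  assumes "f \<in> borel_measurable borel"
  shows "integrable M (\<lambda>\<omega>. f (X i \<omega>)) \<longleftrightarrow> integrable M (\<lambda>\<omega>. f (X 0 \<omega>) :: real)"
    and "(LINT \<omega>|M. f (X i \<omega>)) = (LINT \<omega>|M. f (X 0 \<omega>))"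
proof -
  have "integrable M (\<lambda>\<omega>. f (X j \<omega>)) \<longleftrightarrow> integrable (distr M borel (X j)) f" for j
    using assms by (subst integrable_distr_eq) auto
  then show "integrable M (\<lambda>\<omega>. f (X i \<omega>)) \<longleftrightarrow> integrable M (\<lambda>\<omega>. f (X 0 \<omega>))"
    by (simp only: ident_X[of i])
  have "(LINT \<omega>|M. f (X j \<omega>)) = integral\<^sup>L (distr M borel (X j)) f" for j
    using assms by (subst integral_distr) auto
  then show "(LINT \<omega>|M. f (X i \<omega>)) = (LINT \<omega>|M. f (X 0 \<omega>))"
    by (simp only: ident_X[of i])
qed

lemma integrable_X: "integrable M (X i)"
  using X_transfer(1)[of "\<lambda>x. x" i] integrable_X0 by simp

lemma mean_X: "expectation (X i) = 0"
  using X_transfer(2)[of "\<lambda>x. x" i] mean_X0 by simp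

lemma square_integrable_X: "integrable M (\<lambda>\<omega>. X i \<omega> ^ 2)"
  using X_transfer(1)[of "\<lambda>x. x ^ 2" i] square_integrable_X0 by simp

lemma second_moment_X: "expectation (\<lambda>\<omega>. X i \<omega> ^ 2) = 1"
  using X_transfer(2)[of "\<lambda>x. x ^ 2" i] second_moment_X0 by simp

text \<open>\<open>walk\<close> sums from \<open>X 1\<close> on while \<open>psum\<close> starts at
  index \<open>0\<close>, hence the shift. The moments are prescribed for \<open>X 0\<close>, which
  is not a step of the walk but has the same law.\<close>

definition drifted :: "real \<Rightarrow> nat \<Rightarrow> 'a \<Rightarrow> real" where
  "drifted a i \<omega> = X (Suc i) \<omega> - a"

lemma iid_drifted: "iid_sequence M (drifted a)"
proof
  have "indep_vars (\<lambda>_. borel) (\<lambda>i. X (Suc i)) UNIV"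
    by (rule indep_vars_reindex_inj[OF indep_X]) auto
  then show "indep_vars (\<lambda>_. borel) (drifted a) UNIV"
    unfolding drifted_def[abs_def] by (rule indep_vars_compose2) auto
  have "distr M borel (drifted a i) = distr (distr M borel (X (Suc i))) borel (\<lambda>x. x - a)" for i
    by (subst distr_distr) (auto simp: drifted_def[abs_def] comp_def)
  then show "distr M borel (drifted a i) = distr M borel (drifted a 0)" for i
    using ident_X[of "Suc i"] ident_X[of "Suc 0"] by simp
qed

sublocale drift: iid_sequence M "drifted a" for a
  by (rule iid_drifted)

lemma psum_drifted: "psum (\<lambda>i. drifted a i \<omega>) k = walk X a k \<omega>"
proof -
  have "(\<Sum>i<k. X (Suc i) \<omega> - a) = (\<Sum>i=1..k. (X i \<omega> - a))"
    by (rule sum.reindex_bij_witness[of _ "\<lambda>i. i - 1" Suc]) auto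
  then show ?thesis by (simp add: psum_def walk_def drifted_def)
qed

lemma above_drifted: "drift.above a j = prob {\<omega> \<in> space M. walk X 0 j \<omega> \<ge> real j * a}"
proof -
  have "walk X a j \<omega> = walk X 0 j \<omega> - real j * a" for \<omega>
    by (simp add: walk_def sum_subtractf)
  then show ?thesis
    unfolding drift.above_def drift.path_prob_def psum_drifted
    by (intro arg_cong[where f=prob]) auto
qed

lemma exit_time_greater_iff: "enat k < exit_time X a \<omega> \<longleftrightarrow> stays_nonneg k (\<lambda>i. drifted a i \<omega>)"
proof -
  have "(\<forall>i. 1 \<le> i \<and> walk X a i \<omega> < 0 \<longrightarrow> k < i) \<longleftrightarrow> (\<forall>i\<le>k. 0 \<le> walk X a i \<omega>)"
  proof safe
    fix i assume *: "\<forall>i. 1 \<le> i \<and> walk X a i \<omega> < 0 \<longrightarrow> k < i" "i \<le> k"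
    show "0 \<le> walk X a i \<omega>"
    proof (cases "i = 0")
      case True
      then show ?thesis by (simp add: walk_def)
    next
      case False
      then show ?thesis using *(1)[rule_format, of i] *(2) by (auto simp: not_less[symmetric])
    qed
  next
    fix i assume "\<forall>i\<le>k. 0 \<le> walk X a i \<omega>" "walk X a i \<omega> < 0"
    then show "k < i" by (meson not_le)
  qed
  then show ?thesis
    unfolding exit_time_def enat_less_INF_iff stays_nonneg_def psum_drifted by auto
qed

lemma prob_exit_time: "prob {\<omega> \<in> space M. exit_time X a \<omega> > enat k} = drift.persist a k"
  unfolding exit_time_greater_iff drift.persist_def drift.path_prob_def ..

lemma walk_second_moment:
  "integrable M (walk X 0 k) \<and> expectation (walk X 0 k) = 0
    \<and> integrable M (\<lambda>\<omega>. (walk X 0 k \<omega>)\<^sup>2) \<and> expectation (\<lambda>\<omega>. (walk X 0 k \<omega>)\<^sup>2) = real k"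
proof (induction k)
  case 0
  then show ?case by (simp add: walk_def[abs_def])
next
  case (Suc k)
  have w: "walk X 0 (Suc k) = (\<lambda>\<omega>. walk X 0 k \<omega> + X (Suc k) \<omega>)"
    by (auto simp: walk_def)
  have iv: "indep_var borel (X (Suc k)) borel (walk X 0 k)"
    using indep_vars_sum[of "{1..k}" "Suc k" X] indep_vars_subset[OF indep_X]
    by (simp add: walk_def[abs_def])
  have p: "integrable M (\<lambda>\<omega>. X (Suc k) \<omega> * walk X 0 k \<omega>)"
    using Suc by (intro indep_var_integrable[OF iv]) (auto intro: integrable_X)
  have e: "expectation (\<lambda>\<omega>. X (Suc k) \<omega> * walk X 0 k \<omega>) = 0"
    using Suc by (subst indep_var_lebesgue_integral[OF iv]) (auto intro: integrable_X simp: mean_X)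
  have sq: "(walk X 0 (Suc k) \<omega>)\<^sup>2 = (walk X 0 k \<omega>)\<^sup>2 + 2 * (X (Suc k) \<omega> * walk X 0 k \<omega>) + (X (Suc k) \<omega>)\<^sup>2" for \<omega>
    unfolding w by (simp add: power2_eq_square algebra_simps)
  show ?case
    unfolding sq unfolding w
    using Suc p e integrable_X[of "Suc k"] square_integrable_X[of "Suc k"] mean_X second_moment_X
    by simp
qed

text \<open>Chebyshev's inequality is crude but holds for all \<open>j\<close>, also beyond
  \<open>n\<close>, where the normal approximation says nothing. It makes \<open>above j / j\<close>
  summable, with a tail beyond \<open>n\<close> of order \<open>1 / (n * a^2)\<close>.\<close>

lemma above_le:
  assumes "0 < a" "1 \<le> j"
  shows "drift.above a j \<le> 1 / (real j * a\<^sup>2)"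
proof -
  have [measurable]: "random_variable borel (walk X 0 j)"
    unfolding walk_def[abs_def] by measurable
  have "drift.above a j \<le> prob {\<omega> \<in> space M. \<bar>walk X 0 j \<omega> - expectation (walk X 0 j)\<bar> \<ge> real j * a}"
    unfolding above_drifted using walk_second_moment[of j]
    by (intro finite_measure_mono) auto
  also have "\<dots> \<le> variance (walk X 0 j) / (real j * a)\<^sup>2"
    using walk_second_moment[of j] assms by (intro Chebyshev_inequality) auto
  also have "variance (walk X 0 j) = real j"
    using walk_second_moment[of j] by simp
  also have "real j / (real j * a)\<^sup>2 = 1 / (real j * a\<^sup>2)"
    using assms by (simp add: power2_eq_square field_simps)
  finally show ?thesis .
qed

lemma above_summable:
  assumes "0 < a"
  shows "summable (\<lambda>j. drift.above a j / real j)"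
proof (rule summable_comparison_test')
  show "summable (\<lambda>j. 1 / a\<^sup>2 * (1 / real j ^ 2))"
    using inverse_power_summable[of 2, where 'a=real] by (intro summable_mult) (simp add: field_simps)
  fix j :: nat assume "1 \<le> j"
  then have "drift.above a j / real j \<le> 1 / (real j * a\<^sup>2) / real j"
    using assms by (intro divide_right_mono above_le) auto
  then show "norm (drift.above a j / real j) \<le> 1 / a\<^sup>2 * (1 / real j ^ 2)"
    by (simp add: drift.above_def drift.path_prob_def power2_eq_square mult_ac)
qed

text \<open>The mean is the sum of the probabilities \<open>persist a k\<close>, that is, the
  exponential series at \<open>z = 1\<close>. The computation runs in \<open>ennreal\<close> and
  shows that the value is finite, so \<open>enn2real\<close> loses nothing.\<close>

lemma mean_exit_time_eq:
  assumes "0 < a"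
  shows "mean_exit_time M X a = exp (\<Sum>j. drift.above a j / real j)"
proof -
  have p: "drift.persist a = exp_coeff (drift.above a)"
    using drift.persist_eq_exp_coeff by (intro ext)
  have s: "drift.persist a sums exp (\<Sum>j. drift.above a j / real j)"
    unfolding p using above_summable[OF assms]
    by (intro exp_coeff_sums) (simp_all add: drift.above_def drift.path_prob_def)
  have "{\<omega> \<in> space M. enat k < exit_time X a \<omega>} \<in> events" for k
    unfolding exit_time_greater_iff using drift.path_event[of "stays_nonneg k" a "\<lambda>i. i"] by simp
  then have "exit_time X a \<in> measurable M (count_space UNIV)"
    by (rule measurable_enatI)
  then have "(\<integral>\<^sup>+ \<omega>. ennreal_of_enat (exit_time X a \<omega>) \<partial>M) = (\<Sum>k. emeasure M {\<omega> \<in> space M. enat k < exit_time X a \<omega>})"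
    by (rule nn_integral_enat_function)
  also have "\<dots> = (\<Sum>k. ennreal (drift.persist a k))"
    by (simp add: emeasure_eq_measure prob_exit_time)
  also have "\<dots> = ennreal (exp (\<Sum>j. drift.above a j / real j))"
    by (rule suminf_ennreal_eq[OF _ s]) (simp add: drift.persist_def drift.path_prob_def)
  finally show ?thesis by (simp add: mean_exit_time_def)
qed

text \<open>The threshold \<open>sqrt (j a) * a\<close> moves with \<open>a\<close>, whereas
  distribution functions converge at fixed points. Fixed levels \<open>z\<close> on either side of
  \<open>x\<close> squeeze the probability, and continuity of the normal tail closes the
  gap.\<close>

lemma CLT_above:
  assumes j: "filterlim j at_top (at_right 0)"
    and x: "((\<lambda>a. sqrt (real (j a)) * a) \<longlongrightarrow> x) (at_right 0)"
  shows "((\<lambda>a. drift.above a (j a)) \<longlongrightarrow> std_normal_tail x) (at_right 0)"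
proof -
  define V where "V k \<omega> = (\<Sum>i<k. X (Suc i) \<omega>) / sqrt (real k * 1\<^sup>2)" for k \<omega>
  have [measurable]: "random_variable borel (V k)" for k
    unfolding V_def by measurable
  have "weak_conv_m (\<lambda>k. distr M borel (V k)) std_normal_distribution"
    unfolding V_def
  proof (rule central_limit_theorem_zero_mean)
    show "indep_vars (\<lambda>i. borel) (\<lambda>i. X (Suc i)) UNIV"
      by (rule indep_vars_reindex_inj[OF indep_X]) auto
    show "distr M borel (X (Suc k)) = distr M borel (X 0)" for k by (rule ident_X)
    show "variance (X (Suc k)) = 1\<^sup>2" for k by (simp add: mean_X second_moment_X)
  qed (auto simp: mean_X square_integrable_X)
  then have cdf: "(\<lambda>k. cdf (distr M borel (V k)) y) \<longlonglongrightarrow> cdf std_normal_distribution y" for y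
    using isCont_cdf_std_normal by (auto simp: weak_conv_m_def weak_conv_def)
  have tail: "((\<lambda>a. prob {\<omega> \<in> space M. y < V (j a) \<omega>}) \<longlongrightarrow> std_normal_tail y) (at_right 0)" for y
  proof -
    have "prob {\<omega> \<in> space M. y < V k \<omega>} = 1 - cdf (distr M borel (V k)) y" for k
    proof -
      have "cdf (distr M borel (V k)) y = prob {\<omega> \<in> space M. V k \<omega> \<le> y}"
        unfolding cdf_def by (subst measure_distr) (auto intro!: arg_cong[where f=prob])
      moreover have "{\<omega> \<in> space M. y < V k \<omega>} = space M - {\<omega> \<in> space M. V k \<omega> \<le> y}" by auto
      ultimately show ?thesis by (simp only:) (rule prob_compl, measurable)
    qed
    then show ?thesis
      unfolding std_normal_tail_eq_cdf
      by (simp only:) (intro tendsto_intros filterlim_compose[OF cdf j])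
  qed
  have above: "drift.above a k = prob {\<omega> \<in> space M. sqrt (real k) * a \<le> V k \<omega>}" if "1 \<le> k" for a k
  proof -
    have "walk X 0 k \<omega> = sqrt (real k) * V k \<omega>" for \<omega>
      using psum_drifted[of 0 \<omega> k] that by (simp add: V_def psum_def drifted_def)
    moreover have "real k * a = sqrt (real k) * (sqrt (real k) * a)" by simp
    ultimately have "real k * a \<le> walk X 0 k \<omega> \<longleftrightarrow> sqrt (real k) * a \<le> V k \<omega>" for \<omega>
      using that by (simp only:) (subst mult_le_cancel_left_pos, auto)
    then show ?thesis unfolding above_drifted by simp
  qed
  have j1: "\<forall>\<^sub>F a in at_right 0. 1 \<le> j a" using j by (simp add: filterlim_at_top)
  show ?thesis
  proof (rule order_tendstoI)
    fix y assume y: "y < std_normal_tail x"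
    have "(std_normal_tail \<longlongrightarrow> std_normal_tail x) (at_right x)"
      using isCont_std_normal_tail[of x] by (simp add: isCont_def filterlim_at_split)
    then have "\<forall>\<^sub>F z in at_right x. y < std_normal_tail z" using y by (rule order_tendstoD)
    then obtain z where z: "x < z" "y < std_normal_tail z"
      unfolding eventually_at_right_field by (metis dense)
    have "\<forall>\<^sub>F a in at_right 0. y < prob {\<omega> \<in> space M. z < V (j a) \<omega>}"
      using tail z by (intro order_tendstoD)
    moreover have "\<forall>\<^sub>F a in at_right 0. sqrt (real (j a)) * a < z"
      using x z by (intro order_tendstoD)
    ultimately show "\<forall>\<^sub>F a in at_right 0. y < drift.above a (j a)"
      using j1
    proof eventually_elim
      case (elim a)
      have "prob {\<omega> \<in> space M. z < V (j a) \<omega>} \<le> drift.above a (j a)"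
        unfolding above[OF elim(3)] using elim by (intro finite_measure_mono) auto
      then show ?case using elim by simp
    qed
  next
    fix y assume y: "std_normal_tail x < y"
    have "(std_normal_tail \<longlongrightarrow> std_normal_tail x) (at_left x)"
      using isCont_std_normal_tail[of x] by (simp add: isCont_def filterlim_at_split)
    then have "\<forall>\<^sub>F z in at_left x. std_normal_tail z < y" using y by (rule order_tendstoD)
    then obtain z where z: "z < x" "std_normal_tail z < y"
      unfolding eventually_at_left_field by (metis dense)
    have "\<forall>\<^sub>F a in at_right 0. prob {\<omega> \<in> space M. z < V (j a) \<omega>} < y"
      using tail z by (intro order_tendstoD)
    moreover have "\<forall>\<^sub>F a in at_right 0. z < sqrt (real (j a)) * a"
      using x z by (intro order_tendstoD)
    ultimately show "\<forall>\<^sub>F a in at_right 0. drift.above a (j a) < y"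
      using j1
    proof eventually_elim
      case (elim a)
      have "drift.above a (j a) \<le> prob {\<omega> \<in> space M. z < V (j a) \<omega>}"
        unfolding above[OF elim(3)] using elim by (intro finite_measure_mono) auto
      then show ?case using elim by simp
    qed
  qed
qed

end

subsection \<open>Asymptotics for small drift\<close>

lemma nat_ceiling_bounds:
  assumes "0 < t" "0 < h"
  shows "1 \<le> nat \<lceil>t / h\<rceil>" "t \<le> real (nat \<lceil>t / h\<rceil>) * h" "real (nat \<lceil>t / h\<rceil>) * h \<le> t + h"
proof -
  have p: "0 < t / h" using assms by simp
  then show "1 \<le> nat \<lceil>t / h\<rceil>" by linarith
  have "t / h \<le> real (nat \<lceil>t / h\<rceil>)" "real (nat \<lceil>t / h\<rceil>) \<le> t / h + 1"
    using p by linarith+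
  then have "t / h * h \<le> real (nat \<lceil>t / h\<rceil>) * h" "real (nat \<lceil>t / h\<rceil>) * h \<le> (t / h + 1) * h"
    using assms by (intro mult_right_mono; simp)+
  then show "t \<le> real (nat \<lceil>t / h\<rceil>) * h" "real (nat \<lceil>t / h\<rceil>) * h \<le> t + h"
    using assms by (simp_all add: distrib_right)
qed

lemma ceiling_time_tendsto:
  assumes "0 < t"
  shows "((\<lambda>a. real (nat \<lceil>t / a\<^sup>2\<rceil>) * a\<^sup>2) \<longlongrightarrow> t) (at_right 0)"
proof (rule tendsto_sandwich)
  have pos: "\<forall>\<^sub>F a in at_right 0. 0 < (a :: real)" by (rule eventually_at_right_less)
  show "\<forall>\<^sub>F a in at_right 0. t \<le> real (nat \<lceil>t / a\<^sup>2\<rceil>) * a\<^sup>2"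
    using pos by eventually_elim (use assms nat_ceiling_bounds in auto)
  show "\<forall>\<^sub>F a in at_right 0. real (nat \<lceil>t / a\<^sup>2\<rceil>) * a\<^sup>2 \<le> t + a\<^sup>2"
    using pos by eventually_elim (use assms nat_ceiling_bounds in auto)
  show "((\<lambda>a. t + a\<^sup>2) \<longlongrightarrow> t) (at_right 0)" by real_asymp
qed (rule tendsto_const)

lemma ceiling_time_at_top:
  assumes "0 < t"
  shows "filterlim (\<lambda>a. nat \<lceil>t / a\<^sup>2\<rceil>) at_top (at_right (0::real))"
  unfolding filterlim_at_top
proof
  fix Z :: nat
  have "filterlim (\<lambda>a::real. t / a\<^sup>2) at_top (at_right 0)" using assms by real_asymp
  then have "\<forall>\<^sub>F a in at_right 0. real Z \<le> t / a\<^sup>2" by (simp add: filterlim_at_top)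
  then show "\<forall>\<^sub>F a in at_right 0. Z \<le> nat \<lceil>t / a\<^sup>2\<rceil>"
    by eventually_elim linarith
qed

lemma suminf_inverse_squares_le:
  assumes "1 \<le> n"
  shows "summable (\<lambda>i. 1 / (real (i + Suc n))\<^sup>2)" "(\<Sum>i. 1 / (real (i + Suc n))\<^sup>2) \<le> 1 / real n"
proof -
  have "(\<lambda>i. 1 / real (i + n)) \<longlonglongrightarrow> 0" by real_asymp
  then have "(\<lambda>i. 1 / real (i + n) - 1 / real (Suc i + n)) sums (1 / real (0 + n) - 0)"
    by (rule telescope_sums')
  then have t: "(\<lambda>i. 1 / real (i + n) - 1 / real (Suc i + n)) sums (1 / real n)" by simp
  have le: "1 / (real (i + Suc n))\<^sup>2 \<le> 1 / real (i + n) - 1 / real (Suc i + n)" for i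
  proof -
    define x where "x = real (i + n)"
    have "0 < x" using assms by (simp add: x_def)
    then have "1 / (x + 1)\<^sup>2 \<le> 1 / (x * (x + 1))"
      by (intro divide_left_mono) (auto simp: power2_eq_square)
    also have "\<dots> = 1 / x - 1 / (x + 1)" using \<open>0 < x\<close> by (simp add: field_simps)
    finally show ?thesis by (simp add: x_def add_ac)
  qed
  show s: "summable (\<lambda>i. 1 / (real (i + Suc n))\<^sup>2)"
    using le by (intro summable_comparison_test'[OF sums_summable[OF t], of 0]) auto
  show "(\<Sum>i. 1 / (real (i + Suc n))\<^sup>2) \<le> 1 / real n"
    using suminf_le[OF le s sums_summable[OF t]] sums_unique[OF t] by simp
qed

lemma exp_minus_one_le:
  assumes "0 \<le> x" "x \<le> (1 :: real)"
  shows "exp x - 1 \<le> 3 * x"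
proof -
  have "(1 - x) * exp x \<le> exp (- x) * exp x"
    using exp_ge_add_one_self[of "- x"] by (intro mult_right_mono) auto
  also have "\<dots> = 1" by (simp add: exp_minus)
  finally have "exp x - 1 \<le> x * exp x" by (simp add: algebra_simps)
  also have "\<dots> \<le> x * 3"
    using assms exp_le by (intro mult_left_mono) (auto intro: order_trans[of _ "exp 1"])
  finally show ?thesis by simp
qed

text \<open>The dominating function for the Riemann sum: near \<open>0\<close> the quotient
  \<open>(exp x - 1) / x\<close> is bounded, and for large \<open>t\<close> a weight of size
  \<open>3 / sqrt t\<close> is divided by \<open>t\<close>.\<close>

lemma integrable_dominator:
  "integrable lborel (\<lambda>t::real. indicator {0..1} t * 3 + indicator {1..} t * (3 / (t * sqrt t)))"
proof (rule Bochner_Integration.integrable_add)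
  show "integrable lborel (\<lambda>t::real. indicator {0..1} t * (3::real))" by simp
  have "(\<integral>\<^sup>+t. ennreal (3 / (t * sqrt t)) * indicator {1..} t \<partial>lborel) = ennreal (0 - (- 6 / sqrt 1))"
  proof (rule nn_integral_FTC_atLeast[where F="\<lambda>t. - 6 / sqrt t"])
    fix t :: real assume t: "1 \<le> t"
    have "sqrt t * sqrt t = t" using t by simp
    then show "((\<lambda>t. - 6 / sqrt t) has_real_derivative 3 / (t * sqrt t)) (at t)"
      using t by (auto intro!: derivative_eq_intros simp: field_simps)
    show "0 \<le> 3 / (t * sqrt t)" using t by simp
  next
    show "((\<lambda>t::real. - 6 / sqrt t) \<longlongrightarrow> 0) at_top" by real_asymp
  qed auto
  moreover have "(\<integral>\<^sup>+t. ennreal (norm (indicator {1..} t * (3 / (t * sqrt t)))) \<partial>lborel)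
      = (\<integral>\<^sup>+t. ennreal (3 / (t * sqrt t)) * indicator {1..} t \<partial>lborel)"
    by (intro nn_integral_cong) (auto split: split_indicator)
  ultimately show "integrable lborel (\<lambda>t::real. indicator {1..} t * (3 / (t * sqrt t)))"
    by (intro integrableI_bounded) auto
qed

text \<open>\<open>\<kappa> a\<close> stands for \<open>a ^ 3 * cramer_sum M (X 0) m a\<close>. That
  it is \<open>o(a^2)\<close> is deduced from \<open>approx\<close> in
  \<open>\<kappa>_tendsto\<close>.\<close>

locale normal_approx = iid_standard M X for M :: "'a measure" and X +
  fixes n :: "real \<Rightarrow> nat" and \<kappa> :: "real \<Rightarrow> real"
  assumes n_scale: "filterlim (\<lambda>a. real (n a) * a\<^sup>2) at_top (at_right 0)"
    and approx: "\<And>\<epsilon>. 0 < \<epsilon> \<Longrightarrow> \<forall>\<^sub>F a in at_right 0. \<forall>j::nat. 1 / a\<^sup>2 \<le> real j \<and> j \<le> n a \<longrightarrow>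
      \<bar>drift.above a j / (std_normal_tail (sqrt (real j) * a) * exp (real j * \<kappa> a)) - 1\<bar> \<le> \<epsilon>"
begin

lemma pos: "\<forall>\<^sub>F a in at_right 0. 0 < (a :: real)"
  by (rule eventually_at_right_less)

lemma n_scale_ge: "\<forall>\<^sub>F a in at_right 0. T \<le> real (n a) * a\<^sup>2"
  using n_scale by (simp add: filterlim_at_top)

lemma above_nonneg: "0 \<le> drift.above a j"
  by (simp add: drift.above_def drift.path_prob_def)

lemma above_le_1: "drift.above a j \<le> 1"
  by (simp add: drift.above_def drift.path_prob_def)

definition \<rho> :: "real \<Rightarrow> nat \<Rightarrow> real" where
  "\<rho> a j = drift.above a j / (std_normal_tail (sqrt (real j) * a) * exp (real j * \<kappa> a))"

lemma above_eq_\<rho>: "drift.above a j = \<rho> a j * (std_normal_tail (sqrt (real j) * a) * exp (real j * \<kappa> a))"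
  using std_normal_tail_pos[of "sqrt (real j) * a"] by (simp add: \<rho>_def)

lemma \<rho>_tendsto:
  assumes "\<forall>\<^sub>F a in at_right 0. 1 / a\<^sup>2 \<le> real (j a) \<and> j a \<le> n a"
  shows "((\<lambda>a. \<rho> a (j a)) \<longlongrightarrow> 1) (at_right 0)"
proof (rule tendstoI)
  fix e :: real assume "0 < e"
  then have "\<forall>\<^sub>F a in at_right 0. \<forall>j::nat. 1 / a\<^sup>2 \<le> real j \<and> j \<le> n a \<longrightarrow> \<bar>\<rho> a j - 1\<bar> \<le> e / 2"
    unfolding \<rho>_def by (intro approx) simp
  with assms show "\<forall>\<^sub>F a in at_right 0. dist (\<rho> a (j a)) 1 < e"
  proof eventually_elim
    case (elim a)
    then have "\<bar>\<rho> a (j a) - 1\<bar> \<le> e / 2" by blast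
    then show ?case using \<open>0 < e\<close> by (simp add: dist_real_def)
  qed
qed

lemma ceiling_time_le_n: "\<forall>\<^sub>F a in at_right 0. nat \<lceil>t / a\<^sup>2\<rceil> \<le> n a" if "0 < t"
  using n_scale_ge[of "t + 1"] pos order_tendstoD(2)[OF ceiling_time_tendsto[OF that] less_add_one]
proof eventually_elim
  case (elim a)
  then have "real (nat \<lceil>t / a\<^sup>2\<rceil>) * a\<^sup>2 \<le> real (n a) * a\<^sup>2" by linarith
  then have "real (nat \<lceil>t / a\<^sup>2\<rceil>) \<le> real (n a)"
    by (rule mult_right_le_imp_le) (use elim in simp)
  then show ?case by (simp only: of_nat_le_iff)
qed

lemma sqrt_ceiling_time_tendsto:
  assumes "0 < t"
  shows "((\<lambda>a. sqrt (real (nat \<lceil>t / a\<^sup>2\<rceil>)) * a) \<longlongrightarrow> sqrt t) (at_right 0)"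
proof -
  have "((\<lambda>a. sqrt (real (nat \<lceil>t / a\<^sup>2\<rceil>) * a\<^sup>2)) \<longlongrightarrow> sqrt t) (at_right 0)"
    by (intro tendsto_intros ceiling_time_tendsto assms)
  moreover have "\<forall>\<^sub>F a in at_right 0. sqrt (real (nat \<lceil>t / a\<^sup>2\<rceil>) * a\<^sup>2) = sqrt (real (nat \<lceil>t / a\<^sup>2\<rceil>)) * a"
    using pos by eventually_elim (simp add: real_sqrt_mult)
  ultimately show ?thesis by (rule Lim_transform_eventually)
qed

text \<open>At \<open>j \<approx> 1 / a\<^sup>2\<close> the central limit theorem applies too; comparing it with the assumed
  approximation leaves no room for the exponential factor.\<close>

lemma \<kappa>_tendsto: "((\<lambda>a. \<kappa> a / a\<^sup>2) \<longlongrightarrow> 0) (at_right 0)"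
proof -
  define j where "j a = nat \<lceil>1 / a\<^sup>2\<rceil>" for a :: real
  have s: "((\<lambda>a. sqrt (real (j a)) * a) \<longlongrightarrow> 1) (at_right 0)"
    using sqrt_ceiling_time_tendsto[of 1] by (simp add: j_def)
  have p: "((\<lambda>a. drift.above a (j a)) \<longlongrightarrow> std_normal_tail 1) (at_right 0)"
    unfolding j_def by (intro CLT_above ceiling_time_at_top) (use s in \<open>simp_all add: j_def\<close>)
  have t: "((\<lambda>a. std_normal_tail (sqrt (real (j a)) * a)) \<longlongrightarrow> std_normal_tail 1) (at_right 0)"
    by (rule isCont_tendsto_compose[OF isCont_std_normal_tail s])
  have ev: "\<forall>\<^sub>F a in at_right 0. 1 / a\<^sup>2 \<le> real (j a) \<and> j a \<le> n a"
    using ceiling_time_le_n[OF zero_less_one] unfolding j_def by eventually_elim (auto simp: of_nat_ceiling)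
  have "((\<lambda>a. drift.above a (j a) / (\<rho> a (j a) * std_normal_tail (sqrt (real (j a)) * a)))
      \<longlongrightarrow> std_normal_tail 1 / (1 * std_normal_tail 1)) (at_right 0)"
    using std_normal_tail_pos[of 1] by (intro tendsto_intros p t \<rho>_tendsto ev) simp
  moreover have "\<forall>\<^sub>F a in at_right 0. drift.above a (j a) / (\<rho> a (j a) * std_normal_tail (sqrt (real (j a)) * a))
      = exp (real (j a) * \<kappa> a)"
    using order_tendstoD(1)[OF \<rho>_tendsto[OF ev], of 0, simplified]
  proof eventually_elim
    case (elim a)
    then show ?case
      using std_normal_tail_pos[of "sqrt (real (j a)) * a"] by (simp add: above_eq_\<rho>)
  qed
  ultimately have "((\<lambda>a. exp (real (j a) * \<kappa> a)) \<longlongrightarrow> 1) (at_right 0)"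
    using std_normal_tail_pos[of 1] by (auto intro: Lim_transform_eventually)
  then have "((\<lambda>a. ln (exp (real (j a) * \<kappa> a))) \<longlongrightarrow> ln 1) (at_right 0)"
    by (intro tendsto_ln) simp_all
  then have "((\<lambda>a. (real (j a) * \<kappa> a) / (real (j a) * a\<^sup>2)) \<longlongrightarrow> 0 / 1) (at_right 0)"
    using ceiling_time_tendsto[of 1] by (intro tendsto_divide) (simp_all add: j_def)
  moreover have "\<forall>\<^sub>F a in at_right 0. (real (j a) * \<kappa> a) / (real (j a) * a\<^sup>2) = \<kappa> a / a\<^sup>2"
    using pos
  proof eventually_elim
    case (elim a)
    then have "1 \<le> j a" unfolding j_def by (intro nat_ceiling_bounds) auto
    then show ?case by simp
  qed
  ultimately show ?thesis by (auto intro: Lim_transform_eventually)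
qed

text \<open>Chosen so that \<open>exp (j * \<kappa> a) * exp (j * \<theta> a) = exp (j * a^2 /
  2)\<close>: the tilt removes the correction factor and the Gaussian decay at once.\<close>

definition \<theta> :: "real \<Rightarrow> real" where
  "\<theta> a = a\<^sup>2 / 2 - \<kappa> a"

lemma \<theta>_tendsto: "((\<lambda>a. \<theta> a / a\<^sup>2) \<longlongrightarrow> 1 / 2) (at_right 0)"
proof -
  have "((\<lambda>a. 1 / 2 - \<kappa> a / a\<^sup>2) \<longlongrightarrow> 1 / 2 - 0) (at_right 0)"
    by (intro tendsto_intros \<kappa>_tendsto)
  moreover have "\<forall>\<^sub>F a in at_right 0. 1 / 2 - \<kappa> a / a\<^sup>2 = \<theta> a / a\<^sup>2"
    using pos by eventually_elim (simp add: \<theta>_def field_simps)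
  ultimately show ?thesis by (auto intro: Lim_transform_eventually)
qed

lemma \<theta>_bounds: "\<forall>\<^sub>F a in at_right 0. 0 < a \<and> 0 \<le> \<theta> a \<and> \<theta> a \<le> a\<^sup>2"
proof -
  have "\<forall>\<^sub>F a in at_right 0. 0 < \<theta> a / a\<^sup>2" "\<forall>\<^sub>F a in at_right 0. \<theta> a / a\<^sup>2 < 1"
    using \<theta>_tendsto by (auto intro: order_tendstoD)
  with pos show ?thesis
    by eventually_elim (simp_all add: zero_less_divide_iff field_simps)
qed

text \<open>The cut-off at \<open>n a\<close> discards the range in which the tilted probabilities
  are not controlled, and makes the weights summable. The coefficient at \<open>n a\<close> does not
  change, since its recursion uses weights up to \<open>n a\<close> only.\<close>

definition q :: "real \<Rightarrow> nat \<Rightarrow> real" where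
  "q a j = (if j \<le> n a then drift.above a j * exp (real j * \<theta> a) else 0)"

lemma q_eq_\<rho>:
  assumes "0 < a" "j \<le> n a"
  shows "q a j = \<rho> a j * (std_normal_tail (sqrt (real j * a\<^sup>2)) * exp (real j * a\<^sup>2 / 2))"
proof -
  have "exp (real j * \<kappa> a) * exp (real j * \<theta> a) = exp (real j * a\<^sup>2 / 2)"
    by (simp add: exp_add[symmetric] \<theta>_def algebra_simps)
  then show ?thesis
    using assms by (simp add: q_def above_eq_\<rho> real_sqrt_mult mult.assoc)
qed

text \<open>The constant \<open>3\<close> bounds \<open>e\<close>: if \<open>j * a^2 < 1\<close>,
  then \<open>above\<close> is at most \<open>1\<close> and \<open>j * \<theta> a\<close> is at most
  \<open>1\<close>. Otherwise \<open>approx\<close> with \<open>\<epsilon> = 1\<close> gives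
  \<open>\<rho> <= 2\<close>, and \<open>2 / sqrt (2 * pi) <= 1\<close>.\<close>

lemma weights: "\<forall>\<^sub>F a in at_right 0. inverse_sqrt_weights (q a) 3 (a\<^sup>2)"
  using \<theta>_bounds approx[of 1, simplified, folded \<rho>_def]
proof eventually_elim
  case (elim a)
  have a: "0 < a" "0 \<le> \<theta> a" "\<theta> a \<le> a\<^sup>2" using elim by auto
  have small: "q a j \<le> 3" if "real j * a\<^sup>2 < 1" for j
  proof (cases "j \<le> n a")
    case True
    have "real j * \<theta> a \<le> real j * a\<^sup>2" using a by (intro mult_left_mono) auto
    then have "exp (real j * \<theta> a) \<le> exp 1" using that by simp
    also note exp_le
    finally have "drift.above a j * exp (real j * \<theta> a) \<le> 1 * 3"
      by (intro mult_mono above_le_1) auto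
    then show ?thesis using True by (simp add: q_def)
  qed (simp add: q_def)
  have large: "q a j \<le> 1 / sqrt (real j * a\<^sup>2)" if j: "1 \<le> real j * a\<^sup>2" for j
  proof (cases "j \<le> n a")
    case True
    define t where "t = real j * a\<^sup>2"
    define g where "g = std_normal_tail (sqrt t) * exp (t / 2)"
    have t: "0 < t" using j by (simp add: t_def)
    have "1 / a\<^sup>2 \<le> real j" using j a by (simp add: field_simps)
    with True elim have "\<bar>\<rho> a j - 1\<bar> \<le> 1" by blast
    then have \<rho>: "\<rho> a j \<le> 2" by linarith
    have "2 \<le> sqrt (2 * pi)" using pi_gt3 by (intro real_le_rsqrt) (auto simp: power2_eq_square)
    have "q a j * sqrt t = \<rho> a j * (g * sqrt t)"
      using q_eq_\<rho>[OF a(1) True] by (simp add: g_def t_def)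
    also have "\<dots> \<le> 2 * (1 / sqrt (2 * pi))"
      using \<rho> scaled_tail_bounds(1)[OF t] t unfolding g_def
      by (intro mult_mono) (auto simp: std_normal_tail_nonneg)
    also have "\<dots> \<le> 1" using \<open>2 \<le> sqrt (2 * pi)\<close> by simp
    finally show ?thesis using t by (simp add: t_def field_simps)
  next
    case False
    then show ?thesis by (simp add: q_def)
  qed
  have sqrt_ge: "1 \<le> sqrt (real j * a\<^sup>2)" if "1 \<le> real j * a\<^sup>2" for j
    using that by simp
  show ?case
  proof
    show "0 < a\<^sup>2" using a by simp
    show "0 \<le> q a j" for j by (simp add: q_def above_nonneg)
    show "q a j \<le> 3" for j
    proof (cases "real j * a\<^sup>2 < 1")
      case False
      then have "q a j \<le> 1 / sqrt (real j * a\<^sup>2)" using large by simp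
      also have "\<dots> \<le> 1" using sqrt_ge[of j] False by simp
      finally show ?thesis by simp
    qed (rule small)
    show "q a j \<le> 3 / sqrt (real j * a\<^sup>2)" if "1 \<le> j" for j
    proof (cases "real j * a\<^sup>2 < 1")
      case True
      have "0 < sqrt (real j * a\<^sup>2)" "sqrt (real j * a\<^sup>2) \<le> 1" using True that a by auto
      then have "3 \<le> 3 / sqrt (real j * a\<^sup>2)" by (simp add: field_simps)
      then show ?thesis using small[OF True] by linarith
    next
      case False
      then have "q a j \<le> 1 / sqrt (real j * a\<^sup>2)" using large by simp
      also have "\<dots> \<le> 3 / sqrt (real j * a\<^sup>2)" by (intro divide_right_mono) auto
      finally show ?thesis .
    qed
    show "summable (\<lambda>j. q a j / real j)"
      by (rule summable_finite[of "{..n a}"]) (auto simp: q_def)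
  qed simp
qed

text \<open>\<open>exp (k * \<theta> a)\<close> splits along \<open>k = i + (k - i)\<close>, so
  tilting both sequences preserves the recursion.\<close>

lemma exp_coeff_q: "exp_coeff (q a) (n a) = drift.persist a (n a) * exp (real (n a) * \<theta> a)"
proof (rule exp_coeff_unique[symmetric, where N="n a"])
  fix k assume k: "1 \<le> k" "k \<le> n a"
  have "real k * (drift.persist a k * exp (real k * \<theta> a))
      = (\<Sum>i<k. drift.persist a i * drift.above a (k - i)) * exp (real k * \<theta> a)"
    using drift.persist_rec[of k a] by (simp flip: mult.assoc)
  also have "\<dots> = (\<Sum>i<k. (drift.persist a i * exp (real i * \<theta> a)) * q a (k - i))"
    unfolding sum_distrib_right
  proof (rule sum.cong[OF refl])
    fix i assume i: "i \<in> {..<k}"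
    then have "exp (real k * \<theta> a) = exp (real i * \<theta> a) * exp (real (k - i) * \<theta> a)"
      by (simp add: exp_add[symmetric] of_nat_diff algebra_simps)
    then show "drift.persist a i * drift.above a (k - i) * exp (real k * \<theta> a)
        = (drift.persist a i * exp (real i * \<theta> a)) * q a (k - i)"
      using k by (simp add: q_def)
  qed
  finally show "real k * (drift.persist a k * exp (real k * \<theta> a))
      = (\<Sum>i<k. (drift.persist a i * exp (real i * \<theta> a)) * q a (k - i))" .
qed simp_all

section \<open>Renewal asymptotics of the tilted sequence\<close>

definition \<sigma> :: real where "\<sigma> = 1 / sqrt (2 * pi)"

lemma \<sigma>_bounds: "0 < \<sigma>" "\<sigma> \<le> 1"
proof -
  have "1 \<le> sqrt (2 * pi)" using pi_gt3 by simp
  then show "0 < \<sigma>" "\<sigma> \<le> 1" by (simp_all add: \<sigma>_def)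
qed

lemma q_near:
  assumes "0 < \<epsilon>"
  obtains T where "1 \<le> T"
    and "\<forall>\<^sub>F a in at_right 0. \<forall>j. T \<le> real j * a\<^sup>2 \<and> j \<le> n a \<longrightarrow> \<bar>q a j * sqrt (real j * a\<^sup>2) - \<sigma>\<bar> \<le> \<epsilon>"
proof -
  have "\<forall>\<^sub>F t in at_top. dist (std_normal_tail (sqrt t) * exp (t / 2) * sqrt t) \<sigma> < \<epsilon> / 2"
    using scaled_tail_tendsto assms unfolding \<sigma>_def by (intro tendstoD) auto
  then obtain T0 where T0: "\<And>t. T0 \<le> t \<Longrightarrow> \<bar>std_normal_tail (sqrt t) * exp (t / 2) * sqrt t - \<sigma>\<bar> < \<epsilon> / 2"
    unfolding eventually_at_top_linorder dist_real_def by blast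
  define T where "T = max T0 1"
  have "\<forall>\<^sub>F a in at_right 0. \<forall>j. T \<le> real j * a\<^sup>2 \<and> j \<le> n a \<longrightarrow> \<bar>q a j * sqrt (real j * a\<^sup>2) - \<sigma>\<bar> \<le> \<epsilon>"
    using pos approx[OF half_gt_zero[OF assms], folded \<rho>_def]
  proof eventually_elim
    case (elim a)
    show ?case
    proof safe
      fix j assume j: "T \<le> real j * a\<^sup>2" "j \<le> n a"
      define t where "t = real j * a\<^sup>2"
      define g where "g = std_normal_tail (sqrt t) * exp (t / 2) * sqrt t"
      have t: "0 < t" "T0 \<le> t" "1 \<le> t" using j by (auto simp: t_def T_def)
      have g: "\<bar>g - \<sigma>\<bar> < \<epsilon> / 2" "0 \<le> g" "g \<le> \<sigma>"
        using T0[OF t(2)] scaled_tail_bounds(1)[OF t(1)] t by (auto simp: g_def \<sigma>_def std_normal_tail_nonneg)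
      have "1 / a\<^sup>2 \<le> real j" using t elim(1) by (simp add: t_def field_simps)
      with elim j have \<rho>: "\<bar>\<rho> a j - 1\<bar> \<le> \<epsilon> / 2" by auto
      \<comment> \<open>Each summand gets half of \<open>\<epsilon>\<close>: the first because
        \<open>0 <= g <= \<sigma> <= 1\<close>, the second by the choice of
        \<open>T0\<close>.\<close>
      have "q a j * sqrt t - \<sigma> = (\<rho> a j - 1) * g + (g - \<sigma>)"
        using q_eq_\<rho>[OF elim(1) j(2)] by (simp add: g_def t_def algebra_simps)
      moreover have "\<bar>(\<rho> a j - 1) * g\<bar> \<le> \<epsilon> / 2 * 1"
        unfolding abs_mult using \<rho> g \<sigma>_bounds assms by (intro mult_mono) auto
      ultimately show "\<bar>q a j * sqrt (real j * a\<^sup>2) - \<sigma>\<bar> \<le> \<epsilon>"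
        using g(1) unfolding t_def by linarith
    qed
  qed
  then show ?thesis using that[of T] by (auto simp: T_def)
qed

text \<open>\<open>renewal_estimate\<close> is used with \<open>m\<close> about
  \<open>K / a^2\<close>, where \<open>K\<close> is fixed before \<open>a\<close> tends to
  \<open>0\<close>. A large \<open>K\<close> makes the error term small; then \<open>n * a^2\<close>
  tending to infinity makes \<open>n - k\<close> and \<open>n\<close> comparable for all
  \<open>k <= m\<close>.\<close>

lemma renewal_limit:
  "((\<lambda>a. real (n a) * exp_coeff (q a) (n a) * sqrt (real (n a) * a\<^sup>2) / exp (\<Sum>j. q a j / real j)) \<longlongrightarrow> \<sigma>) (at_right 0)"
proof (rule tendstoI)
  fix e :: real assume e: "0 < e"
  \<comment> \<open>The final error is \<open>3 * \<epsilon> + e / 2\<close>, at most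
    \<open>7/8\<close> of \<open>e\<close>; the bound \<open>1\<close> ensures
    \<open>sqrt y <= 2\<close> below.\<close>
  define \<epsilon> where "\<epsilon> = min (e / 8) 1"
  have \<epsilon>: "0 < \<epsilon>" "\<epsilon> \<le> e / 8" "\<epsilon> \<le> 1" using e by (auto simp: \<epsilon>_def)
  obtain T where T: "1 \<le> T" and near: "\<forall>\<^sub>F a in at_right 0. \<forall>j. T \<le> real j * a\<^sup>2 \<and> j \<le> n a
      \<longrightarrow> \<bar>q a j * sqrt (real j * a\<^sup>2) - \<sigma>\<bar> \<le> \<epsilon>"
    using q_near[OF \<epsilon>(1)] by blast
  define B where "B = 10 * 3 * \<sigma> + 200 * 3 ^ 3"
  have B: "0 < B" using \<sigma>_bounds by (simp add: B_def add_pos_pos)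
  \<comment> \<open>From \<open>m * h >= K / 2\<close> it follows that
    \<open>sqrt (m * h) >= 2 * B / e\<close>; \<open>2 <= K\<close> leaves room for rounding
    \<open>K / h\<close> down.\<close>
  define K where "K = max 2 (2 * (2 * B / e)\<^sup>2)"
  have K: "2 \<le> K" "2 * (2 * B / e)\<^sup>2 \<le> K" by (auto simp: K_def)
  have a1: "\<forall>\<^sub>F a in at_right 0. a \<le> (1::real)"
    using eventually_at_right_real[of 0 1] by (auto elim: eventually_mono)
  show "\<forall>\<^sub>F a in at_right 0. dist (real (n a) * exp_coeff (q a) (n a) * sqrt (real (n a) * a\<^sup>2)
      / exp (\<Sum>j. q a j / real j)) \<sigma> < e"
    \<comment> \<open>Of the lower bounds on \<open>n * a^2\<close>, \<open>2 * K\<close> yields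
      \<open>2 * m <= n\<close>, \<open>2 * T\<close> keeps \<open>n - k\<close> in the range of
      \<open>near\<close>, and \<open>2 * K / \<epsilon>\<close> yields
      \<open>n / (n - k) <= 1 + \<epsilon>\<close>.\<close>
    using weights near pos a1 n_scale_ge[of "2 * K"] n_scale_ge[of "2 * T"] n_scale_ge[of "2 * K / \<epsilon>"]
  proof eventually_elim
    case (elim a)
    define h where "h = a\<^sup>2"
    have h: "0 < h" "h \<le> 1" using elim by (auto simp: h_def power_le_one)
    interpret W: inverse_sqrt_weights "q a" 3 h using elim by (simp add: h_def)
    define m where "m = nat \<lfloor>K / h\<rfloor>"
    have "1 \<le> K / h" using h K by (simp add: field_simps)
    then have m1: "1 \<le> m" "real m \<le> K / h" "K / h - 1 \<le> real m" unfolding m_def by linarith+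
    have mh: "real m * h \<le> K" "K / 2 \<le> real m * h"
    proof -
      show "real m * h \<le> K" using m1(2) h by (simp add: field_simps)
      have "(K / h - 1) * h \<le> real m * h" using m1(3) h by (intro mult_right_mono) auto
      moreover have "(K / h - 1) * h = K - h" using h by (simp add: field_simps)
      ultimately show "K / 2 \<le> real m * h" using h K by linarith
    qed
    have nh: "2 * K \<le> real (n a) * h" "2 * T \<le> real (n a) * h" "2 * K / \<epsilon> \<le> real (n a) * h"
      using elim by (auto simp: h_def)
    have "(2 * real m) * h \<le> real (n a) * h" using mh nh by linarith
    then have "2 * real m \<le> real (n a)" using h by simp
    then have m2: "2 * m \<le> n a" by linarith
    have "\<bar>real (n a) * W.c (n a) * sqrt (real (n a) * h) / W.total - \<sigma>\<bar>
      \<le> 3 * \<epsilon> + (10 * 3 * \<sigma> + 200 * 3 ^ 3) / sqrt (real m * h)"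
    proof (rule W.renewal_estimate[OF m1(1) m2])
      show "0 \<le> \<sigma>" using \<sigma>_bounds by simp
      fix k assume k: "k \<le> m"
      define x where "x = real (n a - k)"
      define y where "y = real (n a) / x"
      have x: "real (n a) / 2 \<le> x" "0 < x" "real (n a) = x + real k"
        using k m1 m2 by (auto simp: x_def)
      have "T \<le> x * h"
      proof -
        have "real (n a) / 2 * h \<le> x * h" using x h by (intro mult_right_mono) auto
        then show ?thesis using nh by linarith
      qed
      then have near': "\<bar>q a (n a - k) * sqrt (x * h) - \<sigma>\<bar> \<le> \<epsilon>"
        using elim(2) unfolding x_def h_def by simp
      have y1: "1 \<le> y" using x by (simp add: y_def)
      have "y = 1 + real k / x" using x by (simp add: y_def field_simps)
      also have "real k / x \<le> real m / (real (n a) / 2)"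
        using k x m1 m2 by (intro frac_le) auto
      also have "\<dots> = 2 * (real m * h) / (real (n a) * h)" using h by simp
      also have "\<dots> \<le> 2 * K / (2 * K / \<epsilon>)"
        using mh nh K \<epsilon> h m1 by (intro frac_le) auto
      also have "\<dots> = \<epsilon>" using K by simp
      finally have y2: "y \<le> 1 + \<epsilon>" by simp
      have sy: "1 \<le> sqrt y" "sqrt y \<le> y"
        using y1 real_sqrt_le_mono[of y "y * y"] by (auto simp: mult_le_cancel_left1)
      have xy: "sqrt (real (n a) * h) = sqrt (x * h) * sqrt y"
        using x by (simp add: y_def real_sqrt_mult[symmetric])
      have "q a (n a - k) * sqrt (real (n a) * h) - \<sigma>
          = (q a (n a - k) * sqrt (x * h) - \<sigma>) * sqrt y + \<sigma> * (sqrt y - 1)"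
        unfolding xy by (simp add: algebra_simps)
      moreover have "\<bar>(q a (n a - k) * sqrt (x * h) - \<sigma>) * sqrt y\<bar> \<le> \<epsilon> * 2"
        unfolding abs_mult using near' sy y2 \<epsilon> by (intro mult_mono) auto
      moreover have "\<bar>\<sigma> * (sqrt y - 1)\<bar> \<le> 1 * \<epsilon>"
        unfolding abs_mult using \<sigma>_bounds sy y2 by (intro mult_mono) auto
      ultimately show "\<bar>q a (n a - k) * sqrt (real (n a) * h) - \<sigma>\<bar> \<le> 3 * \<epsilon>" by linarith
    qed
    also have "(10 * 3 * \<sigma> + 200 * 3 ^ 3) / sqrt (real m * h) \<le> B / (2 * B / e)"
      unfolding B_def[symmetric]
    proof (rule divide_left_mono)
      have "(2 * B / e)\<^sup>2 \<le> real m * h" using mh K by linarith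
      then show "2 * B / e \<le> sqrt (real m * h)" by (rule real_le_rsqrt)
      show "0 < sqrt (real m * h) * (2 * B / e)" using B e m1 h by simp
    qed (use B in simp)
    also have "\<dots> = e / 2" using B by simp
    finally have "\<bar>real (n a) * W.c (n a) * sqrt (real (n a) * h) / W.total - \<sigma>\<bar> \<le> 3 * \<epsilon> + e / 2" by simp
    also have "\<dots> < e" using \<epsilon> e by linarith
    finally show ?case by (simp add: dist_real_def W.total_def h_def)
  qed
qed

section \<open>The ratio of the tilted total to the mean exit time\<close>

definition step_fun :: "real \<Rightarrow> real \<Rightarrow> real" where
  "step_fun a t = (\<Sum>j\<in>{1..n a}. drift.above a j * (exp (real j * \<theta> a) - 1) / (real j * a\<^sup>2)
     * indicator {real (j - 1) * a\<^sup>2<..real j * a\<^sup>2} t)"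

text \<open>The length \<open>a^2\<close> of each interval cancels the factor in the denominator. In
  this form the Riemann sum over an unbounded range is open to dominated convergence.\<close>

lemma step_fun_integral:
  assumes "0 < a"
  shows "integral\<^sup>L lborel (step_fun a) = (\<Sum>j\<in>{1..n a}. drift.above a j * (exp (real j * \<theta> a) - 1) / real j)"
proof -
  have "integral\<^sup>L lborel (step_fun a) = (\<Sum>j\<in>{1..n a}. drift.above a j * (exp (real j * \<theta> a) - 1) / (real j * a\<^sup>2)
     * measure lborel {real (j - 1) * a\<^sup>2<..real j * a\<^sup>2})"
    unfolding step_fun_def[abs_def]
    by (subst Bochner_Integration.integral_sum) (auto simp: mult_right_mono)
  also have "\<dots> = (\<Sum>j\<in>{1..n a}. drift.above a j * (exp (real j * \<theta> a) - 1) / real j)"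
  proof (rule sum.cong[OF refl])
    fix j assume "j \<in> {1..n a}"
    then have j: "1 \<le> j" by simp
    then have "measure lborel {real (j - 1) * a\<^sup>2<..real j * a\<^sup>2} = a\<^sup>2"
      by (subst measure_lborel_Ioc) (auto simp: mult_right_mono of_nat_diff algebra_simps)
    then show "drift.above a j * (exp (real j * \<theta> a) - 1) / (real j * a\<^sup>2)
     * measure lborel {real (j - 1) * a\<^sup>2<..real j * a\<^sup>2} = drift.above a j * (exp (real j * \<theta> a) - 1) / real j"
      using assms by simp
  qed
  finally show ?thesis .
qed

lemma step_fun_eq:
  assumes "0 < a" "0 < t"
  defines "j \<equiv> nat \<lceil>t / a\<^sup>2\<rceil>"
  shows "step_fun a t = (if j \<le> n a then drift.above a j * (exp (real j * \<theta> a) - 1) / (real j * a\<^sup>2) else 0)"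
proof -
  have "t \<in> {real (i - 1) * a\<^sup>2<..real i * a\<^sup>2} \<longleftrightarrow> i = j" if "1 \<le> i" for i
  proof -
    have "t \<in> {real (i - 1) * a\<^sup>2<..real i * a\<^sup>2} \<longleftrightarrow> real_of_int (int i) - 1 < t / a\<^sup>2 \<and> t / a\<^sup>2 \<le> real_of_int (int i)"
      using assms that by (auto simp: field_simps of_nat_diff)
    also have "\<dots> \<longleftrightarrow> \<lceil>t / a\<^sup>2\<rceil> = int i" by (auto simp: ceiling_eq_iff)
    also have "\<dots> \<longleftrightarrow> i = j" using that unfolding j_def by auto
    finally show ?thesis .
  qed
  then have "step_fun a t = (\<Sum>i\<in>{1..n a}. if i = j then drift.above a j * (exp (real j * \<theta> a) - 1) / (real j * a\<^sup>2) else 0)"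
    unfolding step_fun_def by (intro sum.cong) auto
  moreover have "1 \<le> j" unfolding j_def using assms by (intro nat_ceiling_bounds) auto
  ultimately show ?thesis by simp
qed

text \<open>For \<open>s = j * a^2\<close> up to \<open>1\<close>, the linear bound of
  \<open>exp x - 1\<close> cancels the division by \<open>s\<close>; beyond that, the numerator is
  below \<open>q a j\<close>, whose inverse square root bound gives \<open>s^(-3/2)\<close>.\<close>

lemma step_fun_bound:
  "\<forall>\<^sub>F a in at_right 0. \<forall>t. \<bar>step_fun a t\<bar> \<le> indicator {0..1} t * 3 + indicator {1..} t * (3 / (t * sqrt t))"
  using weights \<theta>_bounds
proof eventually_elim
  case (elim a)
  have a: "0 < a" "0 \<le> \<theta> a" "\<theta> a \<le> a\<^sup>2" using elim by auto
  interpret W: inverse_sqrt_weights "q a" 3 "a\<^sup>2" using elim by simp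
  show ?case
  proof
    fix t :: real
    show "\<bar>step_fun a t\<bar> \<le> indicator {0..1} t * 3 + indicator {1..} t * (3 / (t * sqrt t))"
    proof (cases "0 < t")
      case False
      have "step_fun a t = 0"
        unfolding step_fun_def
      proof (rule sum.neutral, safe)
        fix j assume "j \<in> {1..n a}"
        have "0 \<le> real (j - 1) * a\<^sup>2" by simp
        then have "\<not> real (j - 1) * a\<^sup>2 < t" using False by linarith
        then show "drift.above a j * (exp (real j * \<theta> a) - 1) / (real j * a\<^sup>2)
            * indicator {real (j - 1) * a\<^sup>2<..real j * a\<^sup>2} t = 0" by simp
      qed
      then show ?thesis by (auto split: split_indicator)
    next
      case True
      define j where "j = nat \<lceil>t / a\<^sup>2\<rceil>"
      define s where "s = real j * a\<^sup>2"
      have j: "1 \<le> j" "t \<le> s" unfolding s_def j_def using a by (intro nat_ceiling_bounds[OF True]; simp)+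
      define u where "u = drift.above a j * (exp (real j * \<theta> a) - 1) / s"
      have s: "0 < s" using j True by linarith
      have u0: "0 \<le> u" using a s above_nonneg by (auto simp: u_def)
      have step: "step_fun a t = (if j \<le> n a then u else 0)"
        using step_fun_eq[OF a(1) True] by (simp add: j_def[symmetric] u_def s_def)
      show ?thesis
      proof (cases "j \<le> n a")
        case False
        then show ?thesis using step True by (auto split: split_indicator)
      next
        case jn: True
        show ?thesis
        proof (cases "s \<le> 1")
          case True
          have "real j * \<theta> a \<le> s" unfolding s_def using a by (intro mult_left_mono) auto
          then have "exp (real j * \<theta> a) - 1 \<le> 3 * (real j * \<theta> a)"
            using True a by (intro exp_minus_one_le) auto
          also have "\<dots> \<le> 3 * s" using \<open>real j * \<theta> a \<le> s\<close> by simp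
          finally have "drift.above a j * (exp (real j * \<theta> a) - 1) \<le> 1 * (3 * s)"
            using a by (intro mult_mono above_le_1) auto
          then have "u \<le> 3" using s by (simp add: u_def field_simps)
          moreover have "indicator {0..1} t = (1 :: real)" using True j \<open>0 < t\<close> by simp
          moreover have "0 \<le> indicator {1..} t * (3 / (t * sqrt t))" using \<open>0 < t\<close> by simp
          moreover have "\<bar>step_fun a t\<bar> = u" using step jn u0 by simp
          ultimately show ?thesis by linarith
        next
          case False
          have "drift.above a j * (exp (real j * \<theta> a) - 1) \<le> q a j"
            using jn above_nonneg[of a j] by (simp add: q_def algebra_simps)
          also have "\<dots> \<le> 3 / sqrt s" unfolding s_def using j by (intro W.r_le_sqrt)
          finally have "u \<le> 3 / sqrt s / s" unfolding u_def using s by (intro divide_right_mono) auto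
          then have us: "u \<le> 3 / (s * sqrt s)" by (simp add: mult.commute)
          \<comment> \<open>The estimate is in terms of the grid point \<open>s\<close>, the
            dominating function in terms of \<open>t <= s\<close>: \<open>x = t\<close> serves
            \<open>t >= 1\<close>, and \<open>x = 1\<close> serves
            \<open>t <= 1 < s\<close>.\<close>
          have dec: "3 / (s * sqrt s) \<le> 3 / (x * sqrt x)" if "0 < x" "x \<le> s" for x
            using that s by (intro divide_left_mono mult_mono mult_pos_pos) auto
          have "u \<le> 3" using us dec[of 1] False by simp
          moreover have "u \<le> 3 / (t * sqrt t)" using us dec[of t] True j by simp
          ultimately show ?thesis using step jn u0 True by (auto split: split_indicator)
        qed
      qed
    qed
  qed
qed

lemma step_fun_tendsto:
  assumes t: "0 < t"
  shows "((\<lambda>a. step_fun a t) \<longlongrightarrow> std_normal_tail (sqrt t) * ((exp (t / 2) - 1) / t)) (at_right 0)"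
proof -
  define j where "j a = nat \<lceil>t / a\<^sup>2\<rceil>" for a :: real
  have jt: "((\<lambda>a. real (j a) * a\<^sup>2) \<longlongrightarrow> t) (at_right 0)"
    unfolding j_def by (rule ceiling_time_tendsto[OF t])
  have p: "((\<lambda>a. drift.above a (j a)) \<longlongrightarrow> std_normal_tail (sqrt t)) (at_right 0)"
    unfolding j_def by (intro CLT_above ceiling_time_at_top sqrt_ceiling_time_tendsto t)
  have "((\<lambda>a. (real (j a) * a\<^sup>2) * (\<theta> a / a\<^sup>2)) \<longlongrightarrow> t * (1 / 2)) (at_right 0)"
    by (intro tendsto_intros jt \<theta>_tendsto)
  moreover have "\<forall>\<^sub>F a in at_right 0. (real (j a) * a\<^sup>2) * (\<theta> a / a\<^sup>2) = real (j a) * \<theta> a"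
    using pos by eventually_elim simp
  ultimately have th: "((\<lambda>a. real (j a) * \<theta> a) \<longlongrightarrow> t / 2) (at_right 0)"
    by (auto intro: Lim_transform_eventually)
  have "((\<lambda>a. drift.above a (j a) * (exp (real (j a) * \<theta> a) - 1) / (real (j a) * a\<^sup>2))
      \<longlongrightarrow> std_normal_tail (sqrt t) * (exp (t / 2) - 1) / t) (at_right 0)"
    using t by (intro tendsto_intros p th jt) simp
  moreover have "\<forall>\<^sub>F a in at_right 0. drift.above a (j a) * (exp (real (j a) * \<theta> a) - 1) / (real (j a) * a\<^sup>2) = step_fun a t"
    using pos ceiling_time_le_n[OF t]
    by eventually_elim (simp add: step_fun_eq t j_def)
  ultimately show ?thesis by (auto intro: Lim_transform_eventually)
qed

lemma step_fun_integral_tendsto: "((\<lambda>a. integral\<^sup>L lborel (step_fun a)) \<longlongrightarrow> ln 2) (at_right 0)"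
proof -
  let ?f = "\<lambda>t. std_normal_tail (sqrt t) * ((exp (t / 2) - 1) / t) * indicator {0<..} t"
  have f0: "0 \<le> ?f t" for t by (auto simp: std_normal_tail_nonneg split: split_indicator)
  have "integral\<^sup>L lborel ?f = enn2real (\<integral>\<^sup>+t. ennreal (?f t) \<partial>lborel)"
    using f0 by (intro integral_eq_nn_integral) auto
  also have "(\<integral>\<^sup>+t. ennreal (?f t) \<partial>lborel)
      = (\<integral>\<^sup>+t. ennreal (std_normal_tail (sqrt t) * ((exp (t / 2) - 1) / t)) * indicator {0<..} t \<partial>lborel)"
    by (intro nn_integral_cong) (auto split: split_indicator)
  also have "\<dots> = ennreal (ln 2)" by (rule nn_integral_tail_ln_2)
  finally have f: "integral\<^sup>L lborel ?f = ln 2" by simp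
  \<comment> \<open>\<open>integral_dominated_convergence_at_top\<close> needs a parameter tending
    to infinity, hence \<open>a = inverse x\<close>.\<close>
  have "((\<lambda>x. integral\<^sup>L lborel (step_fun (inverse x))) \<longlongrightarrow> integral\<^sup>L lborel ?f) at_top"
  proof (rule integral_dominated_convergence_at_top[OF _ _ integrable_dominator])
    show "\<forall>\<^sub>F x in at_top. AE t in lborel. norm (step_fun (inverse x) t)
        \<le> indicator {0..1} t * 3 + indicator {1..} t * (3 / (t * sqrt t))"
      using step_fun_bound unfolding eventually_at_right_to_top by eventually_elim auto
    have *: "((\<lambda>x. step_fun (inverse x) t) \<longlongrightarrow> ?f t) at_top" if "t \<noteq> 0" for t
    proof (cases "0 < t")
      case True
      then show ?thesis using step_fun_tendsto[OF True] by (simp add: filterlim_at_right_to_top)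
    next
      \<comment> \<open>For negative \<open>t\<close> the dominating function is \<open>0\<close>,
        which forces the step functions to vanish.\<close>
      case False
      have "\<forall>\<^sub>F x in at_top. step_fun (inverse x) t = 0"
        using step_fun_bound unfolding eventually_at_right_to_top
      proof eventually_elim
        case (elim x)
        then show ?case using False that by (auto dest!: spec[of _ t] split: split_indicator_asm)
      qed
      then show ?thesis using False by (auto intro: tendsto_eventually)
    qed
    show "AE t in lborel. ((\<lambda>x. step_fun (inverse x) t) \<longlongrightarrow> ?f t) at_top"
      by (rule eventually_mono[OF AE_lborel_singleton[of 0]]) (rule *)
    show "step_fun (inverse x) \<in> borel_measurable lborel" for x
      unfolding step_fun_def[abs_def] by measurable
  qed measurable
  then show ?thesis unfolding f by (simp add: filterlim_at_right_to_top)
qed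

text \<open>Both quantities are exponentials of sums over \<open>j\<close>. Up to \<open>n\<close>
  the exponents differ by the integral of \<open>step_fun\<close>; beyond \<open>n\<close> only the
  untilted sum remains, and \<open>above_le\<close> bounds this remainder \<open>R\<close> by
  \<open>1 / (n * a^2)\<close>.\<close>

lemma total_tendsto:
  "((\<lambda>a. exp (\<Sum>j. q a j / real j) / mean_exit_time M X a) \<longlongrightarrow> 2) (at_right 0)"
proof -
  define R where "R a = (\<Sum>i. drift.above a (i + Suc (n a)) / real (i + Suc (n a)))" for a
  have R: "\<forall>\<^sub>F a in at_right 0. 0 \<le> R a \<and> R a \<le> 1 / (real (n a) * a\<^sup>2)"
    using pos n_scale_ge[of 1]
  proof eventually_elim
    case (elim a)
    have n1: "1 \<le> n a" using elim by (cases "n a") auto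
    have s: "summable (\<lambda>i. drift.above a (i + Suc (n a)) / real (i + Suc (n a)))"
      using above_summable[OF elim(1)] by (rule summable_ignore_initial_segment)
    have "R a \<le> (\<Sum>i. 1 / a\<^sup>2 * (1 / (real (i + Suc (n a)))\<^sup>2))"
      unfolding R_def
    proof (rule suminf_le[OF _ s])
      fix i
      have "drift.above a (i + Suc (n a)) / real (i + Suc (n a)) \<le> 1 / (real (i + Suc (n a)) * a\<^sup>2) / real (i + Suc (n a))"
        using elim by (intro divide_right_mono above_le) auto
      then show "drift.above a (i + Suc (n a)) / real (i + Suc (n a)) \<le> 1 / a\<^sup>2 * (1 / (real (i + Suc (n a)))\<^sup>2)"
        by (simp add: power2_eq_square mult_ac)
    qed (intro summable_mult suminf_inverse_squares_le n1)
    also have "\<dots> = 1 / a\<^sup>2 * (\<Sum>i. 1 / (real (i + Suc (n a)))\<^sup>2)"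
      by (intro suminf_mult suminf_inverse_squares_le n1)
    also have "\<dots> \<le> 1 / a\<^sup>2 * (1 / real (n a))"
      by (intro mult_left_mono suminf_inverse_squares_le n1) auto
    finally show ?case
      using s unfolding R_def by (auto intro!: suminf_nonneg divide_nonneg_nonneg above_nonneg simp: mult.commute)
  qed
  have "((\<lambda>a. 1 / (real (n a) * a\<^sup>2)) \<longlongrightarrow> 0) (at_right 0)"
    by (rule tendsto_divide_0[OF tendsto_const filterlim_at_top_imp_at_infinity[OF n_scale]])
  then have R0: "(R \<longlongrightarrow> 0) (at_right 0)"
    by (rule tendsto_sandwich[rotated 2, OF tendsto_const]) (use R in \<open>auto elim: eventually_mono\<close>)
  have "((\<lambda>a. exp (integral\<^sup>L lborel (step_fun a) - R a)) \<longlongrightarrow> exp (ln 2 - 0)) (at_right 0)"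
    by (intro tendsto_intros step_fun_integral_tendsto R0)
  moreover have "\<forall>\<^sub>F a in at_right 0. exp (integral\<^sup>L lborel (step_fun a) - R a)
      = exp (\<Sum>j. q a j / real j) / mean_exit_time M X a"
    using pos
  proof eventually_elim
    case (elim a)
    have 1: "(\<Sum>j. drift.above a j / real j) = R a + (\<Sum>j<Suc (n a). drift.above a j / real j)"
      unfolding R_def by (rule suminf_split_initial_segment[OF above_summable[OF elim]])
    have 2: "(\<Sum>j. q a j / real j) = (\<Sum>j<Suc (n a). drift.above a j * exp (real j * \<theta> a) / real j)"
      by (subst suminf_finite[of "{..<Suc (n a)}"]) (auto simp: q_def intro!: sum.cong)
    have 3: "integral\<^sup>L lborel (step_fun a)
        = (\<Sum>j<Suc (n a). drift.above a j * (exp (real j * \<theta> a) - 1) / real j)"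
      unfolding step_fun_integral[OF elim] by (rule sum.mono_neutral_cong_left) (auto simp: not_le)
    have "integral\<^sup>L lborel (step_fun a) - R a = (\<Sum>j. q a j / real j) - (\<Sum>j. drift.above a j / real j)"
      unfolding 1 2 3 by (simp add: sum_subtractf[symmetric] right_diff_distrib diff_divide_distrib)
    then show ?case unfolding mean_exit_time_eq[OF elim] by (simp add: exp_diff)
  qed
  ultimately show ?thesis by (auto intro: Lim_transform_eventually)
qed

text \<open>The scaled normal tail \<open>g\<close> at \<open>n * a^2\<close> has the same limit
  \<open>\<sigma>\<close> as the renewal quantity, so \<open>\<sigma>\<close> cancels and the
  \<open>2\<close> of \<open>total_tendsto\<close> remains. The tilt
  \<open>exp (n * \<theta>)\<close> enters through \<open>exp_coeff_q\<close> and through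
  \<open>g\<close>, and cancels as well.\<close>

lemma exit_time_asymptotics:
  "((\<lambda>a. prob {\<omega> \<in> space M. exit_time X a \<omega> > enat (n a)}
      / (2 * mean_exit_time M X a * (1 / real (n a)) * std_normal_tail (sqrt (real (n a)) * a)
          * exp (real (n a) * \<kappa> a))) \<longlongrightarrow> 1) (at_right 0)"
proof -
  define C where "C a = exp (\<Sum>j. q a j / real j)" for a
  define g where "g a = std_normal_tail (sqrt (real (n a) * a\<^sup>2)) * exp (real (n a) * a\<^sup>2 / 2) * sqrt (real (n a) * a\<^sup>2)" for a
  have g: "(g \<longlongrightarrow> \<sigma>) (at_right 0)"
    unfolding g_def \<sigma>_def by (rule filterlim_compose[OF scaled_tail_tendsto n_scale])
  have "((\<lambda>a. (real (n a) * exp_coeff (q a) (n a) * sqrt (real (n a) * a\<^sup>2) / C a)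
      * (C a / mean_exit_time M X a) / (2 * g a)) \<longlongrightarrow> \<sigma> * 2 / (2 * \<sigma>)) (at_right 0)"
    unfolding C_def using \<sigma>_bounds by (intro tendsto_intros renewal_limit total_tendsto g) simp
  moreover have "\<forall>\<^sub>F a in at_right 0. (real (n a) * exp_coeff (q a) (n a) * sqrt (real (n a) * a\<^sup>2) / C a)
      * (C a / mean_exit_time M X a) / (2 * g a)
    = prob {\<omega> \<in> space M. exit_time X a \<omega> > enat (n a)}
      / (2 * mean_exit_time M X a * (1 / real (n a)) * std_normal_tail (sqrt (real (n a)) * a)
          * exp (real (n a) * \<kappa> a))"
    using pos n_scale_ge[of 1]
  proof eventually_elim
    case (elim a)
    have n1: "1 \<le> n a" using elim by (cases "n a") auto
    define s where "s = sqrt (real (n a) * a\<^sup>2)"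
    define E where "E = exp (real (n a) * \<theta> a)"
    define T where "T = std_normal_tail (sqrt (real (n a)) * a)"
    define K where "K = exp (real (n a) * \<kappa> a)"
    have EK: "exp (real (n a) * a\<^sup>2 / 2) = K * E"
      by (simp add: E_def K_def exp_add[symmetric] \<theta>_def algebra_simps)
    have "s = sqrt (real (n a)) * a" using elim by (simp add: s_def real_sqrt_mult)
    then have ga: "g a = T * (K * E) * s" by (simp add: g_def EK T_def flip: s_def)
    have "0 < s" "0 < E" "0 < K" "0 < T" "0 < C a"
      using elim n1 by (auto simp: s_def E_def K_def T_def C_def std_normal_tail_pos)
    then show ?case
      unfolding exp_coeff_q prob_exit_time ga E_def[symmetric] s_def[symmetric] T_def[symmetric] K_def[symmetric]
      using n1 by (simp add: field_simps)
  qed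
  ultimately show ?thesis
    using \<sigma>_bounds by (auto intro: Lim_transform_eventually)
qed

end

theorem theorem5:
  fixes M :: "'a measure" and X :: "nat \<Rightarrow> 'a \<Rightarrow> real"
    and a0 :: real and m :: enat and n :: "real \<Rightarrow> nat"
  assumes "prob_space M"
    and "prob_space.indep_vars M (\<lambda>_. borel) X UNIV"
    and "\<And>i. distr M borel (X i) = distr M borel (X 0)"
    and "integrable M (X 0)" and "(LINT \<omega>|M. X 0 \<omega>) = 0"
    and "integrable M (\<lambda>\<omega>. X 0 \<omega> ^ 2)" and "(LINT \<omega>|M. X 0 \<omega> ^ 2) = 1"
    and "cramer_sum_defined M (X 0) m"
    and "a0 > 0"
    and "\<And>a. a \<in> {0<..a0} \<Longrightarrow> n a > 0"
    and "filterlim (\<lambda>a. real (n a) * a ^ 2) at_top (at_right 0)"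
    and "\<And>\<epsilon>. \<epsilon> > 0 \<Longrightarrow> \<forall>\<^sub>F a in at_right 0. \<forall>j::nat. 1 / a ^ 2 \<le> real j \<and> j \<le> n a \<longrightarrow>
           \<bar>measure M {\<omega> \<in> space M. walk X 0 j \<omega> \<ge> real j * a}
             / (std_normal_tail (sqrt (real j) * a)
                  * exp (real j * a ^ 3 * cramer_sum M (X 0) m a)) - 1\<bar> \<le> \<epsilon>"
  shows "(\<lambda>a. measure M {\<omega> \<in> space M. exit_time X a \<omega> > enat (n a)})
           \<sim>[at_right 0]
         (\<lambda>a. 2 * mean_exit_time M X a * (1 / real (n a)) * std_normal_tail (sqrt (real (n a)) * a)
                * exp (real (n a) * a ^ 3 * cramer_sum M (X 0) m a))"
proof -
  interpret iid_standard M X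
  proof (unfold iid_standard_def iid_standard_axioms_def, intro conjI allI)
    show "distr M borel (X i) = distr M borel (X 0)" for i by (rule assms(3))
  qed (fact assms)+
  interpret normal_approx M X n "\<lambda>a. a ^ 3 * cramer_sum M (X 0) m a"
  proof
    show "filterlim (\<lambda>a. real (n a) * a\<^sup>2) at_top (at_right 0)" by (rule assms(11))
    show "\<forall>\<^sub>F a in at_right 0. \<forall>j::nat. 1 / a\<^sup>2 \<le> real j \<and> j \<le> n a \<longrightarrow>
      \<bar>drift.above a j / (std_normal_tail (sqrt (real j) * a)
        * exp (real j * (a ^ 3 * cramer_sum M (X 0) m a))) - 1\<bar> \<le> \<epsilon>" if "0 < \<epsilon>" for \<epsilon>
      using assms(12)[OF that] by (simp only: above_drifted mult.assoc)
  qed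
  show ?thesis
    by (rule asymp_equivI') (use exit_time_asymptotics in \<open>simp only: mult.assoc\<close>)
qed

end
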